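(* Let $(G,\lambda)$ be a temporal graph whose underlying graph $G=(V,E)$ has $n$ vertices and $m$ edges, let $T$ be its lifetime and let $\Delta\le T$ be the length of the sliding window. The minimum cardinality of a sliding $\Delta$-window temporal vertex cover of $(G,\lambda)$ can be computed (by a dynamic programming algorithm) in $O(T\Delta(n+m)\cdot 2^{n(\Delta+1)})$ time.
   Context: A temporal graph is a pair $(G,\lambda)$ where $G=(V,E)$ is a finite simple undirected graph and $\lambda:E\to 2^{\mathbb{N}}$ assigns to every edge a finite nonempty set of positive integer time labels, given explicitly; edge $e$ is active at each $t\in\lambda(e)$. The lifetime is $T=\max\{t:t\in\lambda(e),e\in E\}$; the snapshot at time $t$ is $G_t=(V,E_t)$ with $E_t=\{e:t\in\lambda(e)\}$. A vertex appearance is a pair $(v,t)$, $v\in V$, $t\in\{1,\dots,T\}$; it temporally covers edge $e$ if $v$ is an endpoint of $e$ and $t\in\lambda(e)$. For $\Delta\le T$ and $t\in\{1,\dots,T-\Delta+1\}$ let $W_t=\{t,\dots,t+\Delta-1\}$ and $E[W_t]=\bigcup_{i\in W_t}E_i$. A sliding $\Delta$-window temporal vertex cover is a set $\mathcal{S}$ of vertex appearances such that for every $t\in\{1,\dots,T-\Delta+1\}$ and every $e\in E[W_t]$, some $(w,s)\in\mathcal{S}$ with $s\in W_t$ temporally covers $e$. *)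

theory Defs
  imports Main
begin

section \<open>Temporal graphs and sliding-window vertex covers\<close>

definition temporal_graph :: "'v set \<Rightarrow> 'v set set \<Rightarrow> ('v set \<Rightarrow> nat set) \<Rightarrow> bool" where
  "temporal_graph V E lam \<longleftrightarrow>
     finite V \<and> (\<forall>e\<in>E. e \<subseteq> V \<and> card e = 2) \<and>
     (\<forall>e\<in>E. finite (lam e) \<and> lam e \<noteq> {} \<and> 0 \<notin> lam e)"

text \<open>The value for an edgeless graph, where the maximum of all labels does not exist, is 0.
  Hence \<open>1 \<le> \<Delta> \<le> lifetime E lam\<close> forces \<open>E \<noteq> {}\<close>.\<close>

definition lifetime :: "'v set set \<Rightarrow> ('v set \<Rightarrow> nat set) \<Rightarrow> nat" where
  "lifetime E lam = Max (insert 0 (\<Union>e\<in>E. lam e))"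

definition snapshot_edges :: "'v set set \<Rightarrow> ('v set \<Rightarrow> nat set) \<Rightarrow> nat \<Rightarrow> 'v set set" where
  "snapshot_edges E lam t = {e \<in> E. t \<in> lam e}"

definition window :: "nat \<Rightarrow> nat \<Rightarrow> nat set" where
  "window \<Delta> t = {t..<t + \<Delta>}"

definition window_edges :: "'v set set \<Rightarrow> ('v set \<Rightarrow> nat set) \<Rightarrow> nat \<Rightarrow> nat \<Rightarrow> 'v set set" where
  "window_edges E lam \<Delta> t = (\<Union>i\<in>window \<Delta> t. snapshot_edges E lam i)"

definition temporally_covers :: "('v set \<Rightarrow> nat set) \<Rightarrow> 'v \<times> nat \<Rightarrow> 'v set \<Rightarrow> bool" where
  "temporally_covers lam a e \<longleftrightarrow> fst a \<in> e \<and> snd a \<in> lam e"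

definition sliding_window_tvc ::
    "'v set \<Rightarrow> 'v set set \<Rightarrow> ('v set \<Rightarrow> nat set) \<Rightarrow> nat \<Rightarrow> ('v \<times> nat) set \<Rightarrow> bool" where
  "sliding_window_tvc V E lam \<Delta> S \<longleftrightarrow>
     S \<subseteq> V \<times> {1..lifetime E lam} \<and>
     (\<forall>t\<in>{1..lifetime E lam - \<Delta> + 1}. \<forall>e\<in>window_edges E lam \<Delta> t.
        \<exists>a\<in>S. snd a \<in> window \<Delta> t \<and> temporally_covers lam a e)"

definition min_sliding_window_tvc ::
    "'v set \<Rightarrow> 'v set set \<Rightarrow> ('v set \<Rightarrow> nat set) \<Rightarrow> nat \<Rightarrow> nat" where
  "min_sliding_window_tvc V E lam \<Delta> = Min (card ` {S. sliding_window_tvc V E lam \<Delta> S})"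


section \<open>A word RAM\<close>

text \<open>Programs run on registers and a random-access memory. All computed values, and hence all
  addresses, are words of \<open>w\<close> bits; arithmetic is modulo \<open>2 ^ w\<close>, and division by 0 yields 0.
  Structured control flow replaces jumps, which changes running times by a constant factor at
  most.\<close>

datatype binop = Add | Sub | Mul | Div | Less | Equal

datatype exp = Const nat | Reg nat | Load exp | Op binop exp exp

datatype com =
    Skip
  | SetReg nat exp
  | Store exp exp
  | Seq com com
  | Cond exp com com
  | While exp com

type_synonym state = "(nat \<Rightarrow> nat) \<times> (nat \<Rightarrow> nat)"

fun apply_op :: "nat \<Rightarrow> binop \<Rightarrow> nat \<Rightarrow> nat \<Rightarrow> nat" where
  "apply_op w Add a b = (a + b) mod 2 ^ w"
| "apply_op w Sub a b = nat ((int a - int b) mod 2 ^ w)"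
| "apply_op w Mul a b = (a * b) mod 2 ^ w"
| "apply_op w Div a b = a div b"
| "apply_op w Less a b = (if a < b then 1 else 0)"
| "apply_op w Equal a b = (if a = b then 1 else 0)"

fun eval_exp :: "nat \<Rightarrow> exp \<Rightarrow> state \<Rightarrow> nat" where
  "eval_exp w (Const k) s = k mod 2 ^ w"
| "eval_exp w (Reg r) s = fst s r"
| "eval_exp w (Load e) s = snd s (eval_exp w e s)"
| "eval_exp w (Op f e1 e2) s = apply_op w f (eval_exp w e1 s) (eval_exp w e2 s)"

text \<open>Evaluating an expression takes one step per constant, register access, memory access and
  operation in it.\<close>

fun exp_cost :: "exp \<Rightarrow> nat" where
  "exp_cost (Const k) = 1"
| "exp_cost (Reg r) = 1"
| "exp_cost (Load e) = exp_cost e + 1"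
| "exp_cost (Op f e1 e2) = exp_cost e1 + exp_cost e2 + 1"

text \<open>\<open>exec w P s t s'\<close>: with word length \<open>w\<close>, program \<open>P\<close> started in state \<open>s\<close> halts in
  state \<open>s'\<close> after exactly \<open>t\<close> steps. Tests succeed on nonzero values.\<close>

inductive exec :: "nat \<Rightarrow> com \<Rightarrow> state \<Rightarrow> nat \<Rightarrow> state \<Rightarrow> bool" for w where
  Skip: "exec w Skip s 1 s"
| SetReg: "exec w (SetReg r e) s (exp_cost e + 1) ((fst s)(r := eval_exp w e s), snd s)"
| Store: "exec w (Store e1 e2) s (exp_cost e1 + exp_cost e2 + 1)
            (fst s, (snd s)(eval_exp w e1 s := eval_exp w e2 s))"
| Seq: "exec w c1 s1 t1 s2 \<Longrightarrow> exec w c2 s2 t2 s3 \<Longrightarrow> exec w (Seq c1 c2) s1 (t1 + t2) s3"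
| CondTrue: "eval_exp w b s \<noteq> 0 \<Longrightarrow> exec w c1 s t s' \<Longrightarrow>
    exec w (Cond b c1 c2) s (exp_cost b + 1 + t) s'"
| CondFalse: "eval_exp w b s = 0 \<Longrightarrow> exec w c2 s t s' \<Longrightarrow>
    exec w (Cond b c1 c2) s (exp_cost b + 1 + t) s'"
| WhileFalse: "eval_exp w b s = 0 \<Longrightarrow> exec w (While b c) s (exp_cost b + 1) s"
| WhileTrue: "eval_exp w b s1 \<noteq> 0 \<Longrightarrow> exec w c s1 t1 s2 \<Longrightarrow> exec w (While b c) s2 t2 s3 \<Longrightarrow>
    exec w (While b c) s1 (exp_cost b + 1 + t1 + t2) s3"

inductive_cases exec_SkipE: "exec w Skip s t s'"
inductive_cases exec_SetRegE: "exec w (SetReg r e) s t s'"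
inductive_cases exec_StoreE: "exec w (Store e1 e2) s t s'"
inductive_cases exec_SeqE: "exec w (Seq c1 c2) s t s'"
inductive_cases exec_CondE: "exec w (Cond b c1 c2) s t s'"
inductive_cases exec_WhileE: "exec w (While b c) s t s'"

lemma exec_deterministic:
  "exec w c s t s' \<Longrightarrow> exec w c s u s'' \<Longrightarrow> t = u \<and> s' = s''"
proof (induction arbitrary: u s'' rule: exec.induct)
  case (Skip s)
  then show ?case by (rule exec_SkipE) (auto intro: prod_eqI)
next
  case (SetReg r e s)
  then show ?case by (rule exec_SetRegE) (auto intro: prod_eqI)
next
  case (Store e1 e2 s)
  then show ?case by (rule exec_StoreE) (auto intro: prod_eqI)
next
  case (Seq c1 s1 t1 s2 c2 t2 s3)
  from Seq.prems show ?case
  proof (rule exec_SeqE)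
    fix v1 r v2
    assume "u = v1 + v2" "exec w c1 s1 v1 r" "exec w c2 r v2 s''"
    with Seq.IH(1)[of v1 r] Seq.IH(2)[of v2 s''] show ?thesis by simp
  qed
next
  case (CondTrue b s c1 t s' c2)
  from CondTrue.prems show ?case
  proof (rule exec_CondE)
    fix v
    assume "u = Suc (exp_cost b + v)" "exec w c1 s v s''"
    with CondTrue.IH[of v s''] show ?thesis by simp
  next
    assume "eval_exp w b s = 0"
    with CondTrue.hyps(1) show ?thesis by simp
  qed
next
  case (CondFalse b s c2 t s' c1)
  from CondFalse.prems show ?case
  proof (rule exec_CondE)
    assume "0 < eval_exp w b s"
    with CondFalse.hyps(1) show ?thesis by simp
  next
    fix v
    assume "u = Suc (exp_cost b + v)" "exec w c2 s v s''"
    with CondFalse.IH[of v s''] show ?thesis by simp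
  qed
next
  case (WhileFalse b s c)
  from WhileFalse.prems show ?case
    by (rule exec_WhileE) (use WhileFalse.hyps in auto)
next
  case (WhileTrue b s1 c t1 s2 t2 s3)
  from WhileTrue.prems show ?case
  proof (rule exec_WhileE)
    assume "eval_exp w b s1 = 0"
    with WhileTrue.hyps(1) show ?thesis by simp
  next
    fix v1 r v2
    assume "u = Suc (exp_cost b + v1 + v2)" "exec w c s1 v1 r" "exec w (While b c) r v2 s''"
    with WhileTrue.IH(1)[of v1 r] WhileTrue.IH(2)[of v2 s''] show ?thesis by simp
  qed
qed

text \<open>The input is stored from address 0 on, everything else is 0 initially, and the output is
  register 0.\<close>

definition initial_state :: "nat list \<Rightarrow> state" where
  "initial_state xs = ((\<lambda>r. 0), (\<lambda>i. if i < length xs then xs ! i else 0))"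

definition result :: "state \<Rightarrow> nat" where
  "result s = fst s 0"


section \<open>Input encoding\<close>

text \<open>The input consists of the number of vertices, the number of edges and \<open>\<Delta>\<close>, followed by one
  record for each edge: the positions of its endpoints in an enumeration \<open>vs\<close> of the vertices, the
  number of its labels, and these labels. Vertices, edges, the two endpoints of an edge and the
  labels of an edge may each be listed in any order, but without repetition.\<close>

definition edge_record :: "nat \<times> nat \<times> nat list \<Rightarrow> nat list" where
  "edge_record r = (case r of (i, j, ls) \<Rightarrow> [i, j, length ls] @ ls)"

definition encodes ::
    "nat list \<Rightarrow> 'v set \<Rightarrow> 'v set set \<Rightarrow> ('v set \<Rightarrow> nat set) \<Rightarrow> nat \<Rightarrow> bool" where
  "encodes xs V E lam \<Delta> \<longleftrightarrow>
     (\<exists>vs rs.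
        distinct vs \<and> set vs = V \<and>
        distinct (map (\<lambda>(i, j, ls). {vs ! i, vs ! j}) rs) \<and>
        set (map (\<lambda>(i, j, ls). {vs ! i, vs ! j}) rs) = E \<and>
        (\<forall>(i, j, ls)\<in>set rs. i < length vs \<and> j < length vs \<and>
           distinct ls \<and> set ls = lam {vs ! i, vs ! j}) \<and>
        xs = [length vs, length rs, \<Delta>] @ concat (map edge_record rs))"

end

theory Submission
  imports Defs
begin

text \<open>A cover is determined by its layers, one subset of \<open>V\<close> for each time, so a cover is a path of
  masks of \<open>n * \<Delta>\<close> bits, each recording the last \<open>\<Delta>\<close> layers. Whether the window ending at time \<open>t\<close> is
  covered depends on the mask at time \<open>t\<close> only, and a mask has \<open>2 ^ n\<close> possible predecessors, which
  differ in the layer that has left the window. Hence the minimum cost of a path ending in a given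
  mask satisfies a recursion with \<open>T * 2 ^ (n * \<Delta>)\<close> entries, each of which takes \<open>O(2 ^ n)\<close> steps for the
  minimum and \<open>O(n + m * \<Delta>)\<close> steps for counting the newest layer and checking the window.\<close>

section \<open>Time-aware weakest preconditions\<close>

text \<open>The bound is claimed for a machine whose arithmetic wraps and which lacks bit operations
  and remainders, so halting, the result, the step count and the absence of overflow have to be
  established together. \<open>wp\<close> asserts a halting run whose step count and final state
  satisfy \<open>Q\<close>; as \<open>exec\<close> is deterministic, this speaks about the only run.
  Where \<open>fits\<close> holds, the machine computes in the natural numbers, and the invariants
  never mention the modulus. Three choices keep the cost of a table entry at the order of
  \<open>2 ^ n + n + m * \<Delta>\<close>. Stored powers of two reduce access to a bit to a few
  divisions. One flag per pair of label and edge tells in constant time whether the edge is active,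
  without a search in its label list. The layer that leaves the window occupies the lowest
  \<open>n\<close> bits, so all predecessors of a mask sit in consecutive cells. The hypothesis on
  the word length is spent on two facts only: the memory in use is addressable, and every table
  entry is a word.\<close>

definition wp :: "nat \<Rightarrow> com \<Rightarrow> (nat \<Rightarrow> state \<Rightarrow> bool) \<Rightarrow> state \<Rightarrow> bool" where
  "wp w c Q s \<longleftrightarrow> (\<exists>t s'. exec w c s t s' \<and> Q t s')"

fun val :: "exp \<Rightarrow> state \<Rightarrow> nat" where
  "val (Const k) s = k"
| "val (Reg r) s = fst s r"
| "val (Load e) s = snd s (val e s)"
| "val (Op Add a b) s = val a s + val b s"
| "val (Op Sub a b) s = val a s - val b s"
| "val (Op Mul a b) s = val a s * val b s"
| "val (Op Div a b) s = val a s div val b s"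
| "val (Op Less a b) s = of_bool (val a s < val b s)"
| "val (Op Equal a b) s = of_bool (val a s = val b s)"

text \<open>No operation in the expression wraps around modulo \<open>W\<close>, so that \<^const>\<open>val\<close>
  agrees with \<^const>\<open>eval_exp\<close>.\<close>

fun fits :: "nat \<Rightarrow> exp \<Rightarrow> state \<Rightarrow> bool" where
  "fits W (Const k) s \<longleftrightarrow> k < W"
| "fits W (Reg r) s \<longleftrightarrow> True"
| "fits W (Load e) s \<longleftrightarrow> fits W e s"
| "fits W (Op Add a b) s \<longleftrightarrow> fits W a s \<and> fits W b s \<and> val a s + val b s < W"
| "fits W (Op Sub a b) s \<longleftrightarrow> fits W a s \<and> fits W b s \<and> val b s \<le> val a s \<and> val a s < W"
| "fits W (Op Mul a b) s \<longleftrightarrow> fits W a s \<and> fits W b s \<and> val a s * val b s < W"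
| "fits W (Op Div a b) s \<longleftrightarrow> fits W a s \<and> fits W b s"
| "fits W (Op Less a b) s \<longleftrightarrow> fits W a s \<and> fits W b s"
| "fits W (Op Equal a b) s \<longleftrightarrow> fits W a s \<and> fits W b s"

lemma apply_op_Sub: "b \<le> a \<Longrightarrow> a < 2 ^ w \<Longrightarrow> apply_op w Sub a b = a - b"
proof -
  assume le: "b \<le> a" and lt: "a < 2 ^ w"
  have "(int a - int b) mod 2 ^ w = int ((a - b) mod 2 ^ w)"
    using le by (simp add: of_nat_diff zmod_int)
  then show ?thesis
    using lt by simp
qed

lemma eval_exp_eq_val: "fits (2 ^ w) e s \<Longrightarrow> eval_exp w e s = val e s"
proof (induction e)
  case (Op f a b)
  then show ?case
    by (cases f) (simp_all add: apply_op_Sub del: apply_op.simps(2))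
qed auto

lemma wp_mono: "wp w c P s \<Longrightarrow> (\<And>t s'. P t s' \<Longrightarrow> Q t s') \<Longrightarrow> wp w c Q s"
  unfolding wp_def by blast

lemma wp_SkipI: "Q 1 s \<Longrightarrow> wp w Skip Q s"
  unfolding wp_def by (blast intro: exec.Skip)

lemma wp_SetRegI:
  "fits (2 ^ w) e s \<Longrightarrow> Q (exp_cost e + 1) ((fst s)(r := val e s), snd s) \<Longrightarrow> wp w (SetReg r e) Q s"
  using exec.SetReg[of w r e s] unfolding wp_def by (auto simp: eval_exp_eq_val)

lemma wp_StoreI:
  "fits (2 ^ w) a s \<Longrightarrow> fits (2 ^ w) e s \<Longrightarrow>
   Q (exp_cost a + exp_cost e + 1) (fst s, (snd s)(val a s := val e s)) \<Longrightarrow> wp w (Store a e) Q s"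
  using exec.Store[of w a e s] unfolding wp_def by (auto simp: eval_exp_eq_val)

lemma wp_SeqI: "wp w c (\<lambda>t s'. wp w d (\<lambda>u. Q (t + u)) s') s \<Longrightarrow> wp w (Seq c d) Q s"
  unfolding wp_def by (blast intro: exec.Seq)

lemma wp_CondI:
  assumes "fits (2 ^ w) b s"
    and "val b s \<noteq> 0 \<Longrightarrow> wp w c (\<lambda>t. Q (exp_cost b + 1 + t)) s"
    and "val b s = 0 \<Longrightarrow> wp w d (\<lambda>t. Q (exp_cost b + 1 + t)) s"
  shows "wp w (Cond b c d) Q s"
  using assms eval_exp_eq_val[OF assms(1)] unfolding wp_def
  by (cases "val b s = 0") (metis exec.CondFalse, metis exec.CondTrue)

lemmas wp_intros = wp_SeqI wp_SetRegI wp_StoreI wp_CondI wp_SkipI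

definition For :: "nat \<Rightarrow> nat \<Rightarrow> com \<Rightarrow> com" where
  "For r b c = While (Op Less (Reg r) (Reg b)) (Seq c (SetReg r (Op Add (Reg r) (Const 1))))"

text \<open>One iteration pays 4 steps for the test, at most \<open>k\<close> for the body and 4 for
  the increment; the final failing test pays 4 more. The body has to restore \<open>I\<close> for
  the counter already advanced, so the increment never shows up in later obligations. The bound on
  \<open>hi\<close> keeps the counter from wrapping.\<close>

lemma wp_for:
  assumes "lo \<le> hi" "hi < 2 ^ w" "I lo s"
    and bounds: "\<And>i s. lo \<le> i \<Longrightarrow> i \<le> hi \<Longrightarrow> I i s \<Longrightarrow> fst s r = i \<and> fst s b = hi"
    and body: "\<And>i s. lo \<le> i \<Longrightarrow> i < hi \<Longrightarrow> I i s \<Longrightarrow>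
      wp w c (\<lambda>t s'. t \<le> k \<and> fst s' r = i \<and> I (Suc i) ((fst s')(r := Suc i), snd s')) s"
  shows "wp w (For r b c) (\<lambda>t s'. t \<le> (hi - lo) * (k + 8) + 4 \<and> I hi s') s"
proof -
  have "wp w (For r b c) (\<lambda>t s'. t \<le> (hi - l) * (k + 8) + 4 \<and> I hi s') s"
    if "lo \<le> l" "l \<le> hi" "I l s" for l s
    using that
  proof (induction "hi - l" arbitrary: l s)
    case 0
    then have "l = hi"
      by simp
    then have "fst s r = hi \<and> fst s b = hi"
      using bounds[of l s] 0 by simp
    then have "exec w (For r b c) s (exp_cost (Op Less (Reg r) (Reg b)) + 1) s"
      unfolding For_def by (intro exec.WhileFalse) simp
    then show ?case
      using 0 \<open>l = hi\<close> unfolding wp_def by (intro exI[of _ 4] exI[of _ s]) (simp add: eval_nat_numeral)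
  next
    case (Suc d)
    then have lt: "l < hi"
      by simp
    have lim: "fst s r = l" "fst s b = hi"
      using bounds[of l s] Suc.prems by auto
    obtain t s1 where body': "exec w c s t s1" "t \<le> k" "fst s1 r = l"
        "I (Suc l) ((fst s1)(r := Suc l), snd s1)"
      using body[of l s] lt Suc.prems unfolding wp_def by blast
    let ?s = "((fst s1)(r := Suc l), snd s1)"
    have "0 < w"
      using lt assms(2) by (cases w) auto
    then have "eval_exp w (Op Add (Reg r) (Const 1)) s1 = Suc l"
      using body'(3) lt assms(2) by simp
    then have inc: "exec w (SetReg r (Op Add (Reg r) (Const 1))) s1
        (exp_cost (Op Add (Reg r) (Const 1)) + 1) ?s"
      using exec.SetReg[of w r "Op Add (Reg r) (Const 1)" s1] by (simp only:)
    have "wp w (For r b c) (\<lambda>t s'. t \<le> (hi - Suc l) * (k + 8) + 4 \<and> I hi s') ?s"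
      using Suc.hyps Suc.prems lt body'(4) by simp
    then obtain u s2 where rest: "exec w (For r b c) ?s u s2" "u \<le> (hi - Suc l) * (k + 8) + 4"
        "I hi s2"
      unfolding wp_def by blast
    let ?t = "exp_cost (Op Less (Reg r) (Reg b)) + 1 + (t + (exp_cost (Op Add (Reg r) (Const 1)) + 1)) + u"
    have "exec w (For r b c) s ?t s2"
      unfolding For_def
      by (rule exec.WhileTrue[OF _ exec.Seq[OF body'(1) inc] rest(1)[unfolded For_def]])
        (use lt lim in simp)
    moreover have "?t \<le> (hi - l) * (k + 8) + 4"
    proof -
      have "hi - l = Suc (hi - Suc l)"
        using lt by simp
      then show ?thesis
        using body'(2) rest(2) by simp
    qed
    ultimately show ?case
      unfolding wp_def using rest(3) by blast
  qed
  then show ?thesis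
    using assms(1,3) by simp
qed

lemma wp_forI:
  assumes "hi < 2 ^ w" "I lo s" "lo \<le> hi"
    and "\<And>i s. lo \<le> i \<Longrightarrow> i \<le> hi \<Longrightarrow> I i s \<Longrightarrow> fst s r = i \<and> fst s b = hi"
    and "\<And>i s. lo \<le> i \<Longrightarrow> i < hi \<Longrightarrow> I i s \<Longrightarrow>
      wp w c (\<lambda>t s'. t \<le> k \<and> fst s' r = i \<and> I (Suc i) ((fst s')(r := Suc i), snd s')) s"
    and "\<And>t s'. t \<le> (hi - lo) * (k + 8) + 4 \<Longrightarrow> I hi s' \<Longrightarrow> Q t s'"
  shows "wp w (For r b c) Q s"
  by (rule wp_mono[OF wp_for[OF assms(3,1,2,4,5)]]) (use assms(6) in auto)

text \<open>A frame condition for registers only, with \<open>X\<close> the registers that may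
  change. Effects on memory are always stated separately.\<close>

definition unchanged :: "nat set \<Rightarrow> state \<Rightarrow> state \<Rightarrow> bool" where
  "unchanged X s s' \<longleftrightarrow> (\<forall>r. r \<notin> X \<longrightarrow> fst s' r = fst s r)"


section \<open>The program\<close>

abbreviation (input) add_exp (infixl "\<oplus>" 65) where "a \<oplus> b \<equiv> Op Add a b"
abbreviation (input) sub_exp (infixl "\<ominus>" 65) where "a \<ominus> b \<equiv> Op Sub a b"
abbreviation (input) mul_exp (infixl "\<otimes>" 70) where "a \<otimes> b \<equiv> Op Mul a b"
abbreviation (input) div_exp (infixl "\<oslash>" 70) where "a \<oslash> b \<equiv> Op Div a b"
abbreviation (input) assign (infix "::=" 61) where "r ::= e \<equiv> SetReg r e"
abbreviation (input) sequence (infixr ";;" 60) where "c ;; d \<equiv> Seq c d"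

abbreviation (input) "rRes \<equiv> 0 :: nat"
abbreviation (input) "rN \<equiv> 2 :: nat"
abbreviation (input) "rM \<equiv> 3 :: nat"
abbreviation (input) "rDelta \<equiv> 4 :: nat"
abbreviation (input) "rPos \<equiv> 5 :: nat"
abbreviation (input) "rEdge \<equiv> 6 :: nat"
abbreviation (input) "rPow \<equiv> 7 :: nat"
abbreviation (input) "rAct \<equiv> 8 :: nat"
abbreviation (input) "rT \<equiv> 9 :: nat"
abbreviation (input) "rTab \<equiv> 10 :: nat"
abbreviation (input) "rRow \<equiv> 11 :: nat"
abbreviation (input) "rLay \<equiv> 12 :: nat"
abbreviation (input) "rA \<equiv> 13 :: nat"
abbreviation (input) "rI \<equiv> 14 :: nat"
abbreviation (input) "rLim \<equiv> 15 :: nat"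
abbreviation (input) "rQ \<equiv> 16 :: nat"
abbreviation (input) "rEnd \<equiv> 17 :: nat"
abbreviation (input) "rTime \<equiv> 18 :: nat"
abbreviation (input) "rMask \<equiv> 19 :: nat"
abbreviation (input) "rSeen \<equiv> 20 :: nat"
abbreviation (input) "rCov \<equiv> 21 :: nat"
abbreviation (input) "rBad \<equiv> 22 :: nat"
abbreviation (input) "rBits \<equiv> 23 :: nat"
abbreviation (input) "rX \<equiv> 24 :: nat"
abbreviation (input) "rBig \<equiv> 25 :: nat"
abbreviation (input) "rKeep \<equiv> 26 :: nat"
abbreviation (input) "rLen \<equiv> 27 :: nat"

text \<open>Used twice: for the block of predecessors in the recursion and for the last row of the
  table.\<close>

definition min_loop :: com where
  "min_loop =
     rRes ::= Load (Reg rA) ;;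
     rI ::= Const 0 ;;
     For rI rLim
       (Cond (Op Less (Load (Reg rA \<oplus> Reg rI)) (Reg rRes))
          (rRes ::= Load (Reg rA \<oplus> Reg rI)) Skip)"

text \<open>With \<open>q\<close> the mask divided by the stored power, this is
  \<open>q - 2 * (q div 2)\<close>, the parity of \<open>q\<close>.\<close>

definition bit_exp :: "exp \<Rightarrow> exp" where
  "bit_exp k = (Reg rMask \<oslash> Load (Reg rPow \<oplus> k))
     \<ominus> Const 2 \<otimes> (Reg rMask \<oslash> Load (Reg rPow \<oplus> k) \<oslash> Const 2)"

definition count_loop :: com where
  "count_loop =
     rI ::= Const 0 ;;
     For rI rN (rRes ::= Reg rRes \<oplus> bit_exp ((Reg rBits \<ominus> Reg rN) \<oplus> Reg rI))"

definition seen_exp :: exp where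
  "seen_exp = Load (Reg rAct
     \<oplus> ((((Reg rTime \<oplus> Const 1) \<ominus> Reg rDelta) \<oplus> Reg rI) \<otimes> Reg rM \<oplus> Reg rEdge))"

text \<open>The sum acts as a disjunction, since a test succeeds on every nonzero value.\<close>

definition cov_exp :: exp where
  "cov_exp = bit_exp (Reg rN \<otimes> Reg rI \<oplus> Load (Reg rPos))
     \<oplus> bit_exp (Reg rN \<otimes> Reg rI \<oplus> Load (Reg rPos \<oplus> Const 1))"

text \<open>\<open>rCov\<close> is raised only at times at which the edge is active, so it never
  exceeds \<open>rSeen\<close>. The strict inequality between the two flags thus says: active in the
  window, but never covered.\<close>

definition edge_check :: com where
  "edge_check =
     rSeen ::= Const 0 ;;
     rCov ::= Const 0 ;;
     rI ::= Const 0 ;;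
     For rI rDelta
       (Cond seen_exp (Cond cov_exp (rCov ::= Const 1) Skip ;; rSeen ::= Const 1) Skip)"

text \<open>Edge records have different lengths, so the address of the current record is carried
  along in \<open>rPos\<close>.\<close>

definition window_check :: com where
  "window_check =
     rBad ::= Const 0 ;;
     rPos ::= Const 3 ;;
     rEdge ::= Const 0 ;;
     For rEdge rM
       (edge_check ;;
        Cond (Op Less (Reg rCov) (Reg rSeen)) (rBad ::= Const 1) Skip ;;
        rPos ::= Reg rPos \<oplus> Const 3 \<oplus> Load (Reg rPos \<oplus> Const 2))"

definition penalty_step :: com where
  "penalty_step =
     Cond (Op Less (Reg rTime) (Reg rDelta)) Skip
       (window_check ;; Cond (Reg rBad) (rRes ::= Reg rRes \<oplus> Reg rBig) Skip) ;;
     Store (Reg rTab \<oplus> Reg rQ) (Reg rRes)"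

text \<open>A single counter \<open>rQ\<close> sweeps the whole table; division by the row length
  recovers time and mask. The address in \<open>rA\<close> is that of the predecessor with
  \<open>y = 0\<close>: the mask loses its top layer (a remainder modulo \<open>rKeep\<close>) and
  is shifted up by one layer.\<close>

definition table_step :: com where
  "table_step =
     rTime ::= Reg rQ \<oslash> Reg rRow ;;
     rMask ::= Reg rQ \<ominus> Reg rTime \<otimes> Reg rRow ;;
     rA ::= Reg rTab \<oplus> ((Reg rTime \<ominus> Const 1) \<otimes> Reg rRow
       \<oplus> (Reg rMask \<ominus> Reg rMask \<oslash> Reg rKeep \<otimes> Reg rKeep) \<otimes> Reg rLay) ;;
     rLim ::= Reg rLay ;;
     min_loop ;;
     count_loop ;;
     penalty_step"

text \<open>Memory layout behind the input: powers of 2 from \<open>rPow\<close> on; from \<open>rAct\<close> on, the flag of label \<open>l\<close> at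
  edge \<open>e\<close> in cell \<open>l * m + e\<close>; from \<open>rTab\<close> on, the entry for time \<open>t\<close> and mask \<open>M\<close> in cell
  \<open>t * 2 ^ (n * \<Delta>) + M\<close>. The row for time 0 is never written: fresh memory is 0.\<close>

definition read_size :: com where
  "read_size =
     rN ::= Load (Const 0) ;;
     rM ::= Load (Const 1) ;;
     rDelta ::= Load (Const 2) ;;
     rPos ::= Const 3 ;;
     rEdge ::= Const 0 ;;
     For rEdge rM (rPos ::= Reg rPos \<oplus> Const 3 \<oplus> Load (Reg rPos \<oplus> Const 2))"

definition make_powers :: com where
  "make_powers =
     rPow ::= Reg rPos ;;
     rBits ::= Reg rN \<otimes> Reg rDelta ;;
     rLim ::= Reg rBits \<oplus> Const 1 ;;
     rX ::= Const 1 ;;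
     rI ::= Const 0 ;;
     For rI rLim
       (Store (Reg rPow \<oplus> Reg rI) (Reg rX) ;;
        rX ::= Reg rX \<oplus> Reg rX)"

definition read_edge :: com where
  "read_edge =
     rLen ::= Load (Reg rPos \<oplus> Const 2) ;;
     rPos ::= Reg rPos \<oplus> Const 3 ;;
     rI ::= Const 0 ;;
     For rI rLen
       (rX ::= Load (Reg rPos \<oplus> Reg rI) ;;
        Store (Reg rAct \<oplus> (Reg rX \<otimes> Reg rM \<oplus> Reg rEdge)) (Const 1) ;;
        Cond (Op Less (Reg rT) (Reg rX)) (rT ::= Reg rX) Skip) ;;
     rPos ::= Reg rPos \<oplus> Reg rLen"

text \<open>\<open>rLim\<close> still holds \<open>n * \<Delta> + 1\<close>, the number of stored
  powers, so \<open>rAct\<close> is the first cell behind them. The lifetime is not part of the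
  input and is found here as the largest label.\<close>

definition read_labels :: com where
  "read_labels =
     rAct ::= Reg rPow \<oplus> Reg rLim ;;
     rPos ::= Const 3 ;;
     rEdge ::= Const 0 ;;
     rT ::= Const 0 ;;
     For rEdge rM read_edge"

definition fill_table :: com where
  "fill_table =
     rTab ::= Reg rAct \<oplus> (Reg rT \<oplus> Const 1) \<otimes> Reg rM ;;
     rRow ::= Load (Reg rPow \<oplus> Reg rBits) ;;
     rLay ::= Load (Reg rPow \<oplus> Reg rN) ;;
     rKeep ::= Reg rRow \<oslash> Reg rLay ;;
     rBig ::= Reg rN \<otimes> Reg rT \<oplus> Const 1 ;;
     rQ ::= Reg rRow ;;
     rEnd ::= (Reg rT \<oplus> Const 1) \<otimes> Reg rRow ;;
     For rQ rEnd table_step"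

definition read_result :: com where
  "read_result =
     rA ::= Reg rTab \<oplus> Reg rT \<otimes> Reg rRow ;;
     rLim ::= Reg rRow ;;
     min_loop"

definition tvc_com :: com where
  "tvc_com = read_size ;; make_powers ;; read_labels ;; fill_table ;; read_result"


section \<open>Inner loops\<close>

lemma wp_min_loop:
  assumes regs: "fst s rA = a" "fst s rLim = l" and l: "0 < l" "l < 2 ^ w" "a + l \<le> 2 ^ w"
    and post: "\<And>t s'. t \<le> 20 * l + 9 \<Longrightarrow> unchanged {rRes, rI} s s' \<Longrightarrow> snd s' = snd s \<Longrightarrow>
      fst s' rRes = Min ((\<lambda>j. snd s (a + j)) ` {..<l}) \<Longrightarrow> Q t s'"
  shows "wp w min_loop Q s"
proof -
  \<comment> \<open>The witness ranges below \<open>l\<close>, not below \<open>i\<close>, because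
    the first entry is loaded before the loop starts.\<close>
  define I where "I i s' \<longleftrightarrow> unchanged {rRes, rI} s s' \<and> snd s' = snd s \<and> fst s' rI = i \<and>
    (\<forall>j<i. fst s' rRes \<le> snd s (a + j)) \<and> (\<exists>j<l. fst s' rRes = snd s (a + j))" for i s'
  show ?thesis
    unfolding min_loop_def
    apply (intro wp_SeqI wp_SetRegI)
       apply (simp_all add: l)
    apply (rule wp_forI[where I = I and lo = 0 and hi = l and k = 12])
         apply (simp add: l)
    subgoal using regs l by (auto simp: I_def unchanged_def intro: exI[of _ 0])
       apply simp
    subgoal using regs by (auto simp: I_def unchanged_def)
    subgoal for i s'
      apply (intro wp_intros)
      using regs l by (auto simp: I_def unchanged_def less_Suc_eq intro: less_imp_le order_trans)
    subgoal for t s'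
      using regs l
      by (intro post) (auto simp: I_def unchanged_def intro!: Min_eqI[symmetric])
    done
qed


section \<open>The dynamic program\<close>

locale tvc_instance =
  fixes n m \<Delta> T :: nat and src trg :: "nat \<Rightarrow> nat" and labels :: "nat \<Rightarrow> nat list"
begin

text \<open>Bit \<open>n * i + v\<close> of a mask for time \<open>t\<close> stands for the appearance of vertex \<open>v\<close> at time
  \<open>t + 1 + i - \<Delta>\<close>; in particular, the topmost \<open>n\<close> bits belong to time \<open>t\<close> itself.\<close>

definition edge_ok :: "nat \<Rightarrow> nat \<Rightarrow> nat \<Rightarrow> bool" where
  "edge_ok t M e \<longleftrightarrow> ((\<exists>i<\<Delta>. t + 1 - \<Delta> + i \<in> set (labels e)) \<longrightarrow>
     (\<exists>i<\<Delta>. t + 1 - \<Delta> + i \<in> set (labels e) \<and> (bit M (n * i + src e) \<or> bit M (n * i + trg e))))"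

definition window_ok :: "nat \<Rightarrow> nat \<Rightarrow> bool" where
  "window_ok t M \<longleftrightarrow> (\<forall>e<m. edge_ok t M e)"

definition layer_count :: "nat \<Rightarrow> nat" where
  "layer_count M = (\<Sum>v<n. of_bool (bit M (n * \<Delta> - n + v)))"

definition penalty :: "nat \<Rightarrow> nat \<Rightarrow> nat" where
  "penalty t M = (if \<Delta> \<le> t \<and> \<not> window_ok t M then n * T + 1 else 0)"

text \<open>Uncovered windows cost \<open>n * T + 1\<close>, more than any cover, so that no infinite entries are
  needed. Every entry for time 0 is 0, because appearances before time 1 lie in no window.\<close>

primrec table :: "nat \<Rightarrow> nat \<Rightarrow> nat" where
  "table 0 M = 0"
| "table (Suc t) M = Min ((\<lambda>y. table t (M mod 2 ^ (n * \<Delta> - n) * 2 ^ n + y)) ` {..<2 ^ n})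
     + layer_count M + penalty (Suc t) M"

lemma layer_count_le: "layer_count M \<le> n"
proof -
  have "layer_count M \<le> (\<Sum>v<n. 1)"
    unfolding layer_count_def by (intro sum_mono) simp
  then show ?thesis
    by simp
qed

text \<open>The minimum is bounded by its member \<open>y = 0\<close>, and each time adds at most
  \<open>n\<close> for the layer and \<open>n * T + 1\<close> for the penalty. This bound makes
  table entries fit into words.\<close>

lemma table_le: "table t M \<le> t * (n + (n * T + 1))"
proof (induction t arbitrary: M)
  case (Suc t)
  have "Min ((\<lambda>y. table t (M mod 2 ^ (n * \<Delta> - n) * 2 ^ n + y)) ` {..<2 ^ n})
      \<le> table t (M mod 2 ^ (n * \<Delta> - n) * 2 ^ n + 0)"
    by (intro Min_le) (simp, intro imageI, simp)
  also have "\<dots> \<le> t * (n + (n * T + 1))"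
    by (rule Suc)
  finally show ?case
    using layer_count_le[of M] by (simp add: penalty_def)
qed simp

end

text \<open>\<open>pos e\<close> is the address of the record of edge \<open>e\<close>. The summands
  of \<open>memory_bound\<close> are the consecutive areas of memory: input, powers, label flags,
  and the \<open>T + 1\<close> rows of the table. \<open>value_bound\<close> is the bound of
  \<open>table_le\<close> at the last row.\<close>

locale tvc_program = tvc_instance +
  fixes w :: nat and pos :: "nat \<Rightarrow> nat"
  assumes pos_0: "pos 0 = 3"
    and pos_Suc: "e < m \<Longrightarrow> pos (Suc e) = pos e + 3 + length (labels e)"
    and src_less: "e < m \<Longrightarrow> src e < n"
    and trg_less: "e < m \<Longrightarrow> trg e < n"
    and label_le: "e < m \<Longrightarrow> l \<in> set (labels e) \<Longrightarrow> l \<le> T"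
    and length_labels_le: "e < m \<Longrightarrow> length (labels e) \<le> T"
    and T_attained: "\<exists>e<m. T \<in> set (labels e)"
    and Delta_pos: "0 < \<Delta>"
    and Delta_le: "\<Delta> \<le> T"
    and n_pos: "0 < n"
    and memory_bound: "pos m + n * \<Delta> + 1 + (T + 1) * m + (T + 1) * 2 ^ (n * \<Delta>) \<le> 2 ^ w"
    and value_bound: "T * (n + (n * T + 1)) < 2 ^ w"
begin

definition pow_base :: nat where "pow_base = pos m"
definition act_base :: nat where "act_base = pow_base + n * \<Delta> + 1"
definition tab_base :: nat where "tab_base = act_base + (T + 1) * m"

definition input_ok :: "(nat \<Rightarrow> nat) \<Rightarrow> bool" where
  "input_ok \<mu> \<longleftrightarrow> (\<forall>e<m. \<mu> (pos e) = src e \<and> \<mu> (pos e + 1) = trg e \<and>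
     \<mu> (pos e + 2) = length (labels e) \<and> (\<forall>i<length (labels e). \<mu> (pos e + 3 + i) = labels e ! i))"

definition powers_ok :: "(nat \<Rightarrow> nat) \<Rightarrow> bool" where
  "powers_ok \<mu> \<longleftrightarrow> (\<forall>k\<le>n * \<Delta>. \<mu> (pow_base + k) = 2 ^ k)"

definition labels_ok :: "(nat \<Rightarrow> nat) \<Rightarrow> bool" where
  "labels_ok \<mu> \<longleftrightarrow> (\<forall>e<m. \<forall>t\<le>T. \<mu> (act_base + (t * m + e)) = of_bool (t \<in> set (labels e)))"

definition regs_ok :: "(nat \<Rightarrow> nat) \<Rightarrow> bool" where
  "regs_ok R \<longleftrightarrow> R rN = n \<and> R rM = m \<and> R rDelta = \<Delta> \<and> R rPow = pow_base \<and> R rAct = act_base \<and>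
     R rT = T \<and> R rTab = tab_base \<and> R rRow = 2 ^ (n * \<Delta>) \<and> R rLay = 2 ^ n \<and>
     R rKeep = 2 ^ (n * \<Delta> - n) \<and> R rBig = n * T + 1 \<and> R rBits = n * \<Delta>"

section \<open>Address bounds and evaluation of single expressions\<close>

lemma edges_pos: "0 < m"
  using T_attained by auto

lemma tab_bound: "tab_base + (T + 1) * 2 ^ (n * \<Delta>) \<le> 2 ^ w"
  using memory_bound by (simp add: tab_base_def act_base_def pow_base_def)

lemma row_bound: "tab_base + 2 ^ (n * \<Delta>) \<le> 2 ^ w"
  using tab_bound by simp

lemma tab_less: "tab_base < 2 ^ w"
proof -
  have "0 < (2::nat) ^ (n * \<Delta>)"
    by simp
  then show ?thesis
    using row_bound by linarith
qed

lemma pos_mono: "d \<le> e \<Longrightarrow> e \<le> m \<Longrightarrow> pos d \<le> pos e"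
proof (induction e rule: dec_induct)
  case (step e)
  then show ?case
    using pos_Suc[of e] by simp
qed simp

lemma pos_bound: "e < m \<Longrightarrow> pos e + 3 + length (labels e) \<le> pow_base"
  using pos_Suc[of e] pos_mono[of "Suc e" m] by (simp add: pow_base_def)

text \<open>Three header words and at least one record of at least three words. Facts such as
  \<open>3 < 2 ^ w\<close> are drawn from this.\<close>

lemma pow_base_ge: "6 \<le> pow_base"
  using pos_bound[of 0] edges_pos pos_0 by simp

lemma act_addr_less:
  assumes "e < m" "t \<le> T"
  shows "act_base + (t * m + e) < tab_base"
proof -
  have "t * m + e < (t + 1) * m"
    using assms(1) by simp
  also have "\<dots> \<le> (T + 1) * m"
    using assms(2) by (intro mult_right_mono) auto
  finally show ?thesis
    by (simp add: tab_base_def)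
qed

lemma act_less_tab: "act_base < tab_base"
  using edges_pos by (simp add: tab_base_def)

lemma act_base_eq: "act_base = Suc (pow_base + n * \<Delta>)"
  by (simp add: act_base_def)

lemma n_le: "n \<le> n * \<Delta>"
  using Delta_pos by simp

lemma bit_addr_less: "i < \<Delta> \<Longrightarrow> v < n \<Longrightarrow> n * i + v < n * \<Delta>"
proof -
  assume "i < \<Delta>" "v < n"
  then have "n * i + v < n * Suc i"
    by simp
  also have "\<dots> \<le> n * \<Delta>"
    using \<open>i < \<Delta>\<close> by (intro mult_le_mono2) simp
  finally show ?thesis .
qed

lemma cost_bit_exp [simp]: "exp_cost (bit_exp k) = 2 * exp_cost k + 15"
  by (simp add: bit_exp_def)

text \<open>Nothing wraps: for the quotient \<open>q\<close> one has
  \<open>2 * (q div 2) \<le> q \<le> M\<close>, and the mask \<open>M\<close> is below the row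
  length.\<close>

lemma bit_exp_val:
  assumes "regs_ok (fst s)" "powers_ok (snd s)" "fst s rMask = M" "M < 2 ^ (n * \<Delta>)"
    and "fits (2 ^ w) k s" "val k s = j" "j < n * \<Delta>"
  shows "val (bit_exp k) s = of_bool (bit M j)" and "fits (2 ^ w) (bit_exp k) s"
proof -
  have "M div 2 ^ j \<le> M"
    by simp
  then have q: "M div 2 ^ j < 2 ^ w"
    using assms(4) row_bound by linarith
  have pow: "snd s (pow_base + j) = 2 ^ j"
    using assms(2,7) by (simp add: powers_ok_def)
  have regs: "fst s rPow = pow_base"
    using assms(1) by (simp add: regs_ok_def)
  have two: "2 < (2::nat) ^ w" "pow_base + j < 2 ^ w"
    using row_bound pow_base_ge act_less_tab assms(7) unfolding act_base_eq by linarith+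
  show "val (bit_exp k) s = of_bool (bit M j)"
    using pow regs assms(3,6)
    by (simp add: bit_exp_def bit_iff_odd minus_mult_div_eq_mod flip: mod_2_eq_odd)
  show "fits (2 ^ w) (bit_exp k) s"
    using pow regs two q assms(3,5,6) by (simp add: bit_exp_def)
qed

lemma regs_okD:
  assumes "regs_ok R"
  shows "R rN = n" "R rM = m" "R rDelta = \<Delta>" "R rPow = pow_base" "R rAct = act_base"
    "R rT = T" "R rTab = tab_base" "R rRow = 2 ^ (n * \<Delta>)" "R rLay = 2 ^ n"
    "R rKeep = 2 ^ (n * \<Delta> - n)" "R rBig = n * T + 1" "R rBits = n * \<Delta>"
  using assms by (simp_all add: regs_ok_def)

lemma regs_ok_unchanged:
  assumes "regs_ok (fst s)" "unchanged X s s'"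
    "X \<inter> {rN, rM, rDelta, rPow, rAct, rT, rTab, rRow, rLay, rKeep, rBig, rBits} = {}"
  shows "regs_ok (fst s')"
proof -
  have "fst s' r = fst s r" if "r \<in> {rN, rM, rDelta, rPow, rAct, rT, rTab, rRow, rLay, rKeep, rBig, rBits}" for r
    using assms(2,3) that unfolding unchanged_def by blast
  then show ?thesis
    using assms(1) by (simp add: regs_ok_def)
qed

section \<open>Computing one entry of the table\<close>

lemma wp_count_loop:
  assumes "regs_ok (fst s)" "powers_ok (snd s)" "fst s rMask = M" "M < 2 ^ (n * \<Delta>)"
    and "fst s rRes + n < 2 ^ w"
    and post: "\<And>t s'. t \<le> 36 * n + 6 \<Longrightarrow> unchanged {rRes, rI} s s' \<Longrightarrow> snd s' = snd s \<Longrightarrow>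
      fst s' rRes = fst s rRes + layer_count M \<Longrightarrow> Q t s'"
  shows "wp w count_loop Q s"
proof -
  define c where "c i = (\<Sum>v<i. of_bool (bit M (n * \<Delta> - n + v)) :: nat)" for i
  \<comment> \<open>Hence the room of \<open>n\<close> left above \<open>rRes\<close> suffices for
    every partial sum.\<close>
  have c_le: "c i \<le> i" for i
    using sum_mono[of "{..<i}" "\<lambda>v. of_bool (bit M (n * \<Delta> - n + v)) :: nat" "\<lambda>_. 1"]
    by (simp add: c_def)
  define I where "I i s' \<longleftrightarrow> unchanged {rRes, rI} s s' \<and> snd s' = snd s \<and> fst s' rI = i \<and>
    fst s' rRes = fst s rRes + c i" for i s'
  have nb: "n * \<Delta> < 2 ^ w" "n < 2 ^ w"
    using row_bound act_less_tab n_le unfolding act_base_eq by linarith+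
  have regs: "regs_ok (fst s')" if "I i s'" for i s'
    using that by (intro regs_ok_unchanged[OF assms(1), of "{rRes, rI}"]) (simp_all add: I_def)
  let ?k = "Op Add (Op Sub (Reg rBits) (Reg rN)) (Reg rI)"
  have body: "wp w (SetReg rRes (Op Add (Reg rRes) (bit_exp ?k)))
      (\<lambda>t s''. t \<le> 28 \<and> fst s'' rI = i \<and> I (Suc i) ((fst s'')(rI := Suc i), snd s'')) s'"
    if "i < n" and inv: "I i s'" for i s'
  proof -
    note r = regs_okD[OF regs[OF inv]]
    have M: "fst s' rMask = M" and i: "fst s' rI = i" and mem: "snd s' = snd s"
      and res: "fst s' rRes = fst s rRes + c i"
      using inv assms(3) by (simp_all add: I_def unchanged_def)
    have "n * \<Delta> - n + i < n * \<Delta>"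
      using n_le \<open>i < n\<close> by linarith
    moreover have "fits (2 ^ w) ?k s'" "val ?k s' = n * \<Delta> - n + i"
      using calculation nb n_le by (simp_all add: r i)
    ultimately have b: "val (bit_exp ?k) s' = of_bool (bit M (n * \<Delta> - n + i))"
        "fits (2 ^ w) (bit_exp ?k) s'"
      using bit_exp_val[OF regs[OF inv] _ M assms(4)] assms(2) mem by metis+
    have "fst s rRes + c i + of_bool (bit M (n * \<Delta> - n + i)) < 2 ^ w"
      using c_le[of i] \<open>i < n\<close> assms(5) by auto
    then show ?thesis
      using b inv by (intro wp_SetRegI) (simp_all add: I_def unchanged_def c_def)
  qed
  show ?thesis
    unfolding count_loop_def
    apply (intro wp_SeqI wp_SetRegI)
     apply simp
    apply (rule wp_forI[where I = I and lo = 0 and hi = n and k = 28])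
         apply (simp add: nb)
        apply (simp add: I_def unchanged_def c_def)
       apply simp
    subgoal for i s' using regs[of i s'] regs_okD(1) by (simp add: I_def)
     apply (rule body; simp)
    subgoal for t s'
      by (intro post) (auto simp: I_def unchanged_def c_def layer_count_def)
    done
qed

lemma cost_seen_exp [simp]: "exp_cost seen_exp = 14"
  by (simp add: seen_exp_def)

lemma cost_cov_exp [simp]: "exp_cost cov_exp = 59"
  by (simp add: cov_exp_def)

lemma seen_exp_val:
  assumes "regs_ok (fst s)" "labels_ok (snd s)"
    and t: "fst s rTime = t" "\<Delta> \<le> t" "t \<le> T" and e: "fst s rEdge = e" "e < m"
    and i: "fst s rI = i" "i < \<Delta>"
  shows "val seen_exp s = of_bool (t + 1 - \<Delta> + i \<in> set (labels e))" and "fits (2 ^ w) seen_exp s"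
proof -
  note r = regs_okD[OF assms(1)]
  let ?j = "t + 1 - \<Delta> + i"
  have j: "?j \<le> T"
    using i t by simp
  have addr: "act_base + (t * m + e) < tab_base" "act_base + (?j * m + e) < tab_base" "0 < act_base"
    using act_addr_less[OF e(2) j] act_addr_less[OF e(2) t(3)] by (simp_all add: act_base_eq)
  \<comment> \<open>As \<open>m\<close> is positive, the bound on the address of a flag also bounds
    the bare time.\<close>
  have le: "t \<le> t * m" "?j \<le> ?j * m"
    using edges_pos by simp_all
  have b: "t + 1 < 2 ^ w" "1 < (2::nat) ^ w" "?j * m + e < 2 ^ w" "?j < 2 ^ w" "?j * m < 2 ^ w"
    using addr le tab_less pow_base_ge act_less_tab by linarith+
  show "val seen_exp s = of_bool (?j \<in> set (labels e))"
    using assms(2) e j unfolding labels_ok_def by (simp add: seen_exp_def r t i)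
  show "fits (2 ^ w) seen_exp s"
    using addr b tab_less t by (simp add: seen_exp_def r i e)
qed

lemma cov_exp_val:
  assumes regs: "regs_ok (fst s)" and mem: "powers_ok (snd s)" "input_ok (snd s)"
    and M: "fst s rMask = M" "M < 2 ^ (n * \<Delta>)"
    and e: "e < m" "fst s rPos = pos e" and i: "fst s rI = i" "i < \<Delta>"
  shows "val cov_exp s = of_bool (bit M (n * i + src e)) + of_bool (bit M (n * i + trg e))"
    and "fits (2 ^ w) cov_exp s"
proof -
  note r = regs_okD[OF regs]
  let ?k = "Op Add (Op Mul (Reg rN) (Reg rI)) (Load (Reg rPos))"
  let ?l = "Op Add (Op Mul (Reg rN) (Reg rI)) (Load (Op Add (Reg rPos) (Const 1)))"
  have in_mem: "snd s (pos e) = src e" "snd s (Suc (pos e)) = trg e"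
    using mem(2) e by (simp_all add: input_ok_def)
  have less: "n * i + src e < n * \<Delta>" "n * i + trg e < n * \<Delta>"
    using bit_addr_less[OF i(2)] src_less[OF e(1)] trg_less[OF e(1)] by simp_all
  have small: "n * \<Delta> < 2 ^ w" "Suc (pos e) < 2 ^ w" "2 < (2::nat) ^ w"
    using tab_less act_less_tab pos_bound[OF e(1)] pow_base_ge unfolding act_base_eq by linarith+
  have kl: "fits (2 ^ w) ?k s" "fits (2 ^ w) ?l s" "val ?k s = n * i + src e" "val ?l s = n * i + trg e"
    using less small by (simp_all add: r e i in_mem)
  note b = bit_exp_val[OF regs mem(1) M kl(1,3) less(1)] bit_exp_val[OF regs mem(1) M kl(2,4) less(2)]
  show "val cov_exp s = of_bool (bit M (n * i + src e)) + of_bool (bit M (n * i + trg e))"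
    unfolding cov_exp_def val.simps b ..
  show "fits (2 ^ w) cov_exp s"
    unfolding cov_exp_def fits.simps b using b small by simp
qed

lemma wp_edge_check:
  assumes regs: "regs_ok (fst s)" and mem: "powers_ok (snd s)" "labels_ok (snd s)" "input_ok (snd s)"
    and M: "fst s rMask = M" "M < 2 ^ (n * \<Delta>)" and t: "fst s rTime = t" "\<Delta> \<le> t" "t \<le> T"
    and e: "fst s rEdge = e" "e < m" "fst s rPos = pos e"
    and post: "\<And>u s'. u \<le> 100 * \<Delta> + 10 \<Longrightarrow> unchanged {rSeen, rCov, rI} s s' \<Longrightarrow> snd s' = snd s \<Longrightarrow>
      fst s' rCov < fst s' rSeen \<longleftrightarrow> \<not> edge_ok t M e \<Longrightarrow> Q u s'"
  shows "wp w edge_check Q s"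
proof -
  define seen where "seen i \<longleftrightarrow> t + 1 - \<Delta> + i \<in> set (labels e)" for i
  define cov where "cov i \<longleftrightarrow> bit M (n * i + src e) \<or> bit M (n * i + trg e)" for i
  define I where "I i s' \<longleftrightarrow> unchanged {rSeen, rCov, rI} s s' \<and> snd s' = snd s \<and> fst s' rI = i \<and>
    fst s' rSeen = of_bool (\<exists>j<i. seen j) \<and> fst s' rCov = of_bool (\<exists>j<i. seen j \<and> cov j)" for i s'
  have small: "\<Delta> < 2 ^ w" "1 < (2::nat) ^ w"
    using tab_less act_less_tab n_pos mult_le_mono1[of 1 n \<Delta>] pow_base_ge
    unfolding act_base_eq by linarith+
  have regs': "regs_ok (fst s')" if "I i s'" for i s'
    using that by (intro regs_ok_unchanged[OF regs, of "{rSeen, rCov, rI}"]) (simp_all add: I_def)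
  have body: "wp w
      (Cond seen_exp (Seq (Cond cov_exp (SetReg rCov (Const 1)) Skip) (SetReg rSeen (Const 1))) Skip)
      (\<lambda>u s''. u \<le> 92 \<and> fst s'' rI = i \<and> I (Suc i) ((fst s'')(rI := Suc i), snd s'')) s'"
    if i: "i < \<Delta>" and inv: "I i s'" for i s'
  proof -
    have s': "fst s' rMask = M" "fst s' rI = i" "fst s' rTime = t" "fst s' rEdge = e"
      "fst s' rPos = pos e" "powers_ok (snd s')" "labels_ok (snd s')" "input_ok (snd s')"
      using inv M t e mem by (simp_all add: I_def unchanged_def)
    note sv = seen_exp_val[OF regs'[OF inv] s'(7,3) t(2,3) s'(4) e(2) s'(2) i, folded seen_def]
    note cv = cov_exp_val[OF regs'[OF inv] s'(6,8,1) M(2) e(2) s'(5,2) i]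
    have vals: "val seen_exp s' = of_bool (seen (fst s' rI))" "val cov_exp s' = 0 \<longleftrightarrow> \<not> cov (fst s' rI)"
      by (simp_all add: sv cv cov_def s')
    show ?thesis
      using inv sv(2) cv(2) small(2)
      by (intro wp_intros) (auto simp: I_def unchanged_def Ex_less_Suc vals)
  qed
  show ?thesis
    unfolding edge_check_def
    apply (intro wp_SeqI wp_SetRegI)
       apply simp_all
    \<comment> \<open>The body takes at most 79 steps; 92 rounds the cost of an iteration up to
      100.\<close>
    apply (rule wp_forI[where I = I and lo = 0 and hi = \<Delta> and k = 92])
         apply (simp add: small)
        apply (simp add: I_def unchanged_def)
       apply simp
    subgoal for i s' using regs'[of i s'] regs_okD(3) by (simp add: I_def)
     apply (rule body[simplified]; simp)
    subgoal for u s'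
      by (intro post) (auto simp: I_def unchanged_def edge_ok_def seen_def cov_def)
    done
qed

lemma wp_window_check:
  assumes regs: "regs_ok (fst s)" and mem: "powers_ok (snd s)" "labels_ok (snd s)" "input_ok (snd s)"
    and M: "fst s rMask = M" "M < 2 ^ (n * \<Delta>)" and t: "fst s rTime = t" "\<Delta> \<le> t" "t \<le> T"
    and post: "\<And>u s'. u \<le> m * (35 + 100 * \<Delta>) + 10 \<Longrightarrow>
      unchanged {rBad, rPos, rEdge, rSeen, rCov, rI} s s' \<Longrightarrow> snd s' = snd s \<Longrightarrow>
      fst s' rBad = of_bool (\<not> window_ok t M) \<Longrightarrow> Q u s'"
  shows "wp w window_check Q s"
proof -
  define I where "I e s' \<longleftrightarrow> unchanged {rBad, rPos, rEdge, rSeen, rCov, rI} s s' \<and> snd s' = snd s \<and>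
    fst s' rEdge = e \<and> fst s' rPos = pos e \<and> fst s' rBad = of_bool (\<exists>d<e. \<not> edge_ok t M d)" for e s'
  have small: "3 < (2::nat) ^ w"
    using tab_less act_less_tab pow_base_ge unfolding act_base_eq by linarith
  have "m \<le> T * m"
    using Delta_pos t by simp
  then have m: "m < 2 ^ w"
    using tab_less unfolding tab_base_def by simp
  have regs': "regs_ok (fst s')" if "I e s'" for e s'
    using that
    by (intro regs_ok_unchanged[OF regs, of "{rBad, rPos, rEdge, rSeen, rCov, rI}"]) (simp_all add: I_def)
  have body: "wp w
      (Seq edge_check (Seq (Cond (Op Less (Reg rCov) (Reg rSeen)) (SetReg rBad (Const 1)) Skip)
        (SetReg rPos (Op Add (Op Add (Reg rPos) (Const 3)) (Load (Op Add (Reg rPos) (Const 2)))))))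
      (\<lambda>u s''. u \<le> 100 * \<Delta> + 27 \<and> fst s'' rEdge = e \<and> I (Suc e) ((fst s'')(rEdge := Suc e), snd s'')) s'"
    if e: "e < m" and inv: "I e s'" for e s'
  proof -
    have s': "fst s' rMask = M" "fst s' rTime = t" "fst s' rEdge = e" "fst s' rPos = pos e" "snd s' = snd s"
      using inv M t by (simp_all add: I_def unchanged_def)
    have len: "snd s (pos e + 2) = length (labels e)"
      using mem(3) e by (simp add: input_ok_def)
    have "pos e + 3 + length (labels e) < 2 ^ w"
      using tab_less act_less_tab pos_bound[OF e] unfolding act_base_eq by linarith
    then show ?thesis
      apply (intro wp_SeqI)
      apply (rule wp_edge_check[OF regs'[OF inv] _ _ _ s'(1) M(2) s'(2) t(2,3) s'(3) e s'(4)])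
         apply (simp_all add: s' mem)
      apply (intro wp_intros)
      using inv small len e
      by (auto simp: I_def unchanged_def pos_Suc Ex_less_Suc)
  qed
  show ?thesis
    unfolding window_check_def
    apply (intro wp_SeqI wp_SetRegI)
       apply (simp_all add: small)
    apply (rule wp_forI[where I = I and lo = 0 and hi = m and k = "100 * \<Delta> + 27"])
         apply (simp add: m)
        apply (simp add: I_def unchanged_def pos_0)
       apply simp
    subgoal for e s' using regs'[of e s'] regs_okD(2) by (simp add: I_def)
     apply (rule body[simplified]; simp)
    subgoal for u s'
      by (intro post) (auto simp: I_def unchanged_def window_ok_def)
    done
qed


abbreviation (input) "step_regs \<equiv>
  {rRes, rTime, rMask, rA, rLim, rI, rBad, rPos, rEdge, rSeen, rCov}"

lemma wp_penalty_step:
  assumes regs: "regs_ok (fst s)" and mem: "powers_ok (snd s)" "labels_ok (snd s)" "input_ok (snd s)"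
    and M: "fst s rMask = M" "M < 2 ^ (n * \<Delta>)" and t: "fst s rTime = t" "t \<le> T"
    and q: "fst s rQ = q" "tab_base + q < 2 ^ w" and v: "fst s rRes = v" "v + (n * T + 1) < 2 ^ w"
    and post: "\<And>u s'. u \<le> m * (35 + 100 * \<Delta>) + 31 \<Longrightarrow> unchanged step_regs s s' \<Longrightarrow>
      snd s' = (snd s)(tab_base + q := v + penalty t M) \<Longrightarrow> Q u s'"
  shows "wp w penalty_step Q s"
proof -
  note r = regs_okD[OF regs]
  show ?thesis
    unfolding penalty_step_def
    apply (intro wp_SeqI wp_CondI)
      apply simp
    subgoal
      apply (intro wp_intros)
      using q v t apply (simp_all add: r)
      apply (intro post)
        apply (simp_all add: unchanged_def penalty_def)
      done
    subgoal
      apply (rule wp_window_check[OF regs mem M t(1) _ t(2)])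
      using t apply (simp add: r)
      subgoal for u s'
        using regs_okD[OF regs_ok_unchanged[OF regs, of "{rBad, rPos, rEdge, rSeen, rCov, rI}" s']] q v t
        apply (intro wp_intros)
           apply (simp_all add: r unchanged_def)
         apply (intro post; simp add: unchanged_def penalty_def)+
        done
      done
    done
qed

text \<open>All predecessors lie in the row before that of \<open>q\<close>, hence in cells below
  \<open>q\<close>, which are already filled.\<close>

lemma wp_table_step:
  assumes regs: "regs_ok (fst s)" and mem: "powers_ok (snd s)" "labels_ok (snd s)" "input_ok (snd s)"
    and q: "fst s rQ = q" "2 ^ (n * \<Delta>) \<le> q" "q < (T + 1) * 2 ^ (n * \<Delta>)"
    and table: "\<And>p. p < q \<Longrightarrow> snd s (tab_base + p) = table (p div 2 ^ (n * \<Delta>)) (p mod 2 ^ (n * \<Delta>))"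
    and post: "\<And>u s'. u \<le> 20 * 2 ^ n + 36 * n + m * (35 + 100 * \<Delta>) + 85 \<Longrightarrow> unchanged step_regs s s' \<Longrightarrow>
      snd s' = (snd s)(tab_base + q := table (q div 2 ^ (n * \<Delta>)) (q mod 2 ^ (n * \<Delta>))) \<Longrightarrow> Q u s'"
  shows "wp w table_step Q s"
proof -
  note r = regs_okD[OF regs]
  define R where "R = (2::nat) ^ (n * \<Delta>)"
  define S where "S = (2::nat) ^ (n * \<Delta> - n)"
  define K where "K = (2::nat) ^ n"
  define t where "t = q div R - 1"
  define M where "M = q mod R"
  define a where "a = t * R + M mod S * K"
  have pos: "0 < R" "0 < S" "0 < K"
    by (simp_all add: R_def S_def K_def)
  have RSK: "R = S * K"
    using n_le unfolding R_def S_def K_def power_add[symmetric] by simp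
  have M: "M < 2 ^ (n * \<Delta>)" "M < R"
    using pos by (simp_all add: M_def R_def)
  have "1 \<le> q div R"
    using q(2) pos by (simp add: R_def div_greater_zero_iff Suc_le_eq)
  then have t: "q div R = Suc t"
    by (simp add: t_def)
  have "q div R \<le> T"
    using q(3) pos by (simp add: R_def less_mult_imp_div_less less_Suc_eq_le[symmetric])
  then have tT: "Suc t \<le> T"
    using t by simp
  have qM: "Suc t * R + M = q"
    using div_mult_mod_eq[of q R] t by (simp add: M_def)
  \<comment> \<open>The block of \<open>K\<close> predecessors does not cross the end of its
    row.\<close>
  have "M mod S * K + K \<le> S * K"
    using pos mult_le_mono1[of "Suc (M mod S)" S K] by (simp add: Suc_le_eq)
  then have row: "M mod S * K + y < R" if "y < K" for y
    using that RSK by simp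
  have a_le: "a + K \<le> Suc t * R"
    using \<open>M mod S * K + K \<le> S * K\<close> RSK by (simp add: a_def)
  have "q < 2 ^ w" "tab_base + q < 2 ^ w"
    using tab_bound q(3) by simp_all
  have entry: "snd s (tab_base + (a + y)) = table t (M mod S * K + y)" if "y < K" for y
  proof -
    have "a + y < q"
      using a_le qM that by simp
    moreover have "(a + y) div R = t" "(a + y) mod R = M mod S * K + y"
      using row[OF that] pos by (simp_all add: a_def add.assoc)
    ultimately show ?thesis
      using table[of "a + y"] by (simp add: R_def)
  qed
  let ?min = "Min ((\<lambda>y. table t (M mod S * K + y)) ` {..<K})"
  have min: "Min ((\<lambda>y. snd s (tab_base + a + y)) ` {..<K}) = ?min"
    using entry by (intro arg_cong[where f = Min] image_cong) (simp_all add: add.assoc)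
  have "?min \<le> table t (M mod S * K + 0)"
    using pos by (intro Min_le) (simp, intro imageI, simp)
  then have min_le: "?min \<le> t * (n + (n * T + 1))"
    using table_le order_trans by blast
  \<comment> \<open>The minimum accounts for \<open>t\<close> of these \<open>Suc t\<close>
    summands; the remaining one pays for the newest layer and the penalty.\<close>
  have "Suc t * (n + (n * T + 1)) \<le> T * (n + (n * T + 1))"
    using tT by (rule mult_le_mono1)
  then have res: "?min + n + (n * T + 1) < 2 ^ w"
    using min_le value_bound by simp
  have "R \<le> 2 ^ w"
    using row_bound unfolding R_def by linarith
  have q_eq: "R + (M + t * R) = q"
    using qM by simp
  have M_mod: "M - M div S * S = M mod S"
    by (simp add: minus_div_mult_eq_mod)
  have M_eq: "q - (R + t * R) = M" "q - (R + t * R + M div S * S) = M mod S"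
    using q_eq M_mod by linarith+
  have "Suc t * 1 \<le> Suc t * R"
    using pos by (intro mult_le_mono2) simp
  then have "Suc t \<le> Suc t * R"
    by simp
  moreover have "M mod S \<le> M mod S * K" "K \<le> R" "M div S * S \<le> M"
    using pos RSK by simp_all
  moreover have "K + (M mod S * K + t * R) \<le> q"
    using a_le qM by (simp add: a_def)
  moreover have "Suc t * R = R + t * R" "1 \<le> Suc t"
    by simp_all
  \<comment> \<open>Every intermediate value of the address computation is at most
    \<open>tab_base + q\<close>.\<close>
  ultimately have bounds: "t * R + M mod S * K < 2 ^ w" "tab_base + (t * R + M mod S * K) < 2 ^ w"
    "Suc t < 2 ^ w" "t * R < 2 ^ w" "M mod S * K < 2 ^ w" "M div S * S < 2 ^ w" "M < 2 ^ w" "Suc 0 < 2 ^ w"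
    "R + t * R < 2 ^ w" "K < 2 ^ w" "K + (tab_base + (t * R + M mod S * K)) \<le> 2 ^ w"
    using qM \<open>q < 2 ^ w\<close> \<open>tab_base + q < 2 ^ w\<close> pos a_le tab_less act_less_tab pow_base_ge
    unfolding act_base_eq by linarith+
  note bounds = bounds \<open>q < 2 ^ w\<close> \<open>tab_base + q < 2 ^ w\<close>
  show ?thesis
    unfolding table_step_def
    apply (intro wp_SeqI wp_SetRegI)
            apply (simp_all add: r q(1) t M_eq M_mod flip: R_def S_def K_def)
      apply (use q_eq bounds in simp)
     apply (use bounds in simp)
    apply (rule wp_min_loop[where a = "tab_base + a" and l = K])
         apply (simp add: a_def)
        apply simp
       apply (rule pos)
      apply (use bounds in simp)
     apply (use bounds in \<open>simp add: a_def\<close>)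
    apply (simp add: min)
    apply (intro wp_SeqI)
    subgoal for u1 s1
      apply (rule wp_count_loop[where M = M])
           apply (rule regs_ok_unchanged[OF regs, of step_regs])
            apply (simp add: unchanged_def)
           apply simp
          apply (simp add: mem)
         apply (simp add: unchanged_def)
        apply (rule M)
       apply (use res in simp)
      subgoal for u2 s2
        apply (rule wp_penalty_step[where M = M and t = "Suc t" and q = q and v = "?min + layer_count M"])
                   apply (rule regs_ok_unchanged[OF regs, of step_regs])
                    apply (simp add: unchanged_def)
                   apply simp
                  apply (simp_all add: mem M tT bounds)
            apply (simp add: unchanged_def)
           apply (simp add: unchanged_def)
          apply (simp add: unchanged_def q)
         apply (use res layer_count_le[of M] in simp)
        apply (rule post)
          apply (simp add: K_def)
         apply (simp add: unchanged_def)
        apply (simp add: t M_def[symmetric] S_def K_def flip: R_def)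
        done
      done
    done
qed


section \<open>Filling the table and reading off the result\<close>

text \<open>This and the next two lemmas are the frame rules for memory: each predicate reads its
  own area only, so it survives stores elsewhere.\<close>

lemma input_ok_upd:
  assumes "input_ok \<mu>" "\<And>a. a < pow_base \<Longrightarrow> \<mu>' a = \<mu> a"
  shows "input_ok \<mu>'"
  unfolding input_ok_def
proof (intro allI impI)
  fix e assume e: "e < m"
  have "\<mu>' (pos e) = \<mu> (pos e)" "\<mu>' (pos e + 1) = \<mu> (pos e + 1)" "\<mu>' (pos e + 2) = \<mu> (pos e + 2)"
    "i < length (labels e) \<Longrightarrow> \<mu>' (pos e + 3 + i) = \<mu> (pos e + 3 + i)" for i
    using pos_bound[OF e] by (simp_all add: assms(2))
  then show "\<mu>' (pos e) = src e \<and> \<mu>' (pos e + 1) = trg e \<and> \<mu>' (pos e + 2) = length (labels e) \<and>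
      (\<forall>i<length (labels e). \<mu>' (pos e + 3 + i) = labels e ! i)"
    using assms(1) e by (simp add: input_ok_def)
qed

lemma powers_ok_upd:
  assumes "powers_ok \<mu>" "\<And>a. pow_base \<le> a \<Longrightarrow> a < act_base \<Longrightarrow> \<mu>' a = \<mu> a"
  shows "powers_ok \<mu>'"
  using assms by (simp add: powers_ok_def act_base_eq)

lemma labels_ok_upd:
  assumes "labels_ok \<mu>" "\<And>a. act_base \<le> a \<Longrightarrow> a < tab_base \<Longrightarrow> \<mu>' a = \<mu> a"
  shows "labels_ok \<mu>'"
  using assms act_addr_less by (simp add: labels_ok_def)

definition table_filled :: "nat \<Rightarrow> (nat \<Rightarrow> nat) \<Rightarrow> bool" where
  "table_filled q \<mu> \<longleftrightarrow>
     (\<forall>p<q. \<mu> (tab_base + p) = table (p div 2 ^ (n * \<Delta>)) (p mod 2 ^ (n * \<Delta>)))"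

lemma wp_read_result:
  assumes "regs_ok (fst s)" "table_filled ((T + 1) * 2 ^ (n * \<Delta>)) (snd s)"
    and post: "\<And>u s'. u \<le> 20 * 2 ^ (n * \<Delta>) + 20 \<Longrightarrow>
      fst s' rRes = Min (table T ` {..<2 ^ (n * \<Delta>)}) \<Longrightarrow> Q u s'"
  shows "wp w read_result Q s"
proof -
  note r = regs_okD[OF assms(1)]
  define R where "R = (2::nat) ^ (n * \<Delta>)"
  have R: "0 < R"
    by (simp add: R_def)
  have "tab_base + (T * R + R) \<le> 2 ^ w"
    using tab_bound by (simp add: R_def add.commute)
  then have b: "R + (tab_base + T * R) \<le> 2 ^ w" "T * R < 2 ^ w" "tab_base + T * R < 2 ^ w"
    using R by linarith+
  then have "R < 2 ^ w"
    using act_less_tab by linarith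
  have "(\<lambda>j. snd s (tab_base + T * R + j)) ` {..<R} = table T ` {..<R}"
  proof (rule image_cong)
    fix j assume "j \<in> {..<R}"
    then have "T * R + j < (T + 1) * R" "(T * R + j) div R = T" "(T * R + j) mod R = j"
      by simp_all
    then show "snd s (tab_base + T * R + j) = table T j"
      using assms(2) unfolding table_filled_def R_def[symmetric] by (metis add.assoc)
  qed simp
  then show ?thesis
    unfolding read_result_def
    using b \<open>R < 2 ^ w\<close> R
    apply (intro wp_SeqI wp_SetRegI)
       apply (simp_all add: r flip: R_def)
    apply (rule wp_min_loop[where a = "tab_base + T * R" and l = R])
         apply (simp_all add: add.assoc)
     apply (simp add: ac_simps)
    apply (rule post)
     apply (simp_all flip: R_def)
    done
qed

lemma wp_fill_table:
  assumes regs: "fst s rN = n" "fst s rM = m" "fst s rDelta = \<Delta>" "fst s rPow = pow_base"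
      "fst s rAct = act_base" "fst s rT = T" "fst s rBits = n * \<Delta>"
    and mem: "powers_ok (snd s)" "labels_ok (snd s)" "input_ok (snd s)"
    and zero: "\<And>a. tab_base \<le> a \<Longrightarrow> snd s a = 0"
    and post: "\<And>u s'. u \<le> T * 2 ^ (n * \<Delta>) * (20 * 2 ^ n + 36 * n + m * (35 + 100 * \<Delta>) + 93) + 50 \<Longrightarrow>
      regs_ok (fst s') \<Longrightarrow> table_filled ((T + 1) * 2 ^ (n * \<Delta>)) (snd s') \<Longrightarrow> Q u s'"
  shows "wp w fill_table Q s"
proof -
  define R where "R = (2::nat) ^ (n * \<Delta>)"
  define F where "F = ((fst s)(rTab := tab_base, rRow := R, rLay := 2 ^ n, rKeep := 2 ^ (n * \<Delta> - n),
    rBig := n * T + 1, rQ := R, rEnd := (T + 1) * R))"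
  define I where "I q s' \<longleftrightarrow> unchanged (insert rQ step_regs) (F, snd s) s' \<and>
    powers_ok (snd s') \<and> labels_ok (snd s') \<and> input_ok (snd s') \<and> fst s' rQ = q \<and>
    table_filled q (snd s')" for q s'
  have R: "0 < R"
    by (simp add: R_def)
  have F: "regs_ok F"
    by (simp add: F_def regs_ok_def regs R_def)
  have regs': "regs_ok (fst s')" if "I q s'" for q s'
    using regs_ok_unchanged[of "(F, snd s)" "insert rQ step_regs" s'] F that by (simp add: I_def)
  \<comment> \<open>The row for time 0 counts as filled at once, since both \<open>table 0\<close>
    and untouched memory are 0.\<close>
  have init: "I R (F, snd s)"
    using mem by (simp add: I_def unchanged_def F_def table_filled_def zero R_def)
  have body: "wp w table_step
      (\<lambda>u s''. u \<le> 20 * 2 ^ n + 36 * n + m * (35 + 100 * \<Delta>) + 85 \<and> fst s'' rQ = q \<and>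
        I (Suc q) ((fst s'')(rQ := Suc q), snd s'')) s'"
    if q: "R \<le> q" "q < (T + 1) * R" and inv: "I q s'" for q s'
  proof (rule wp_table_step[OF regs'[OF inv]])
    show "powers_ok (snd s')" "labels_ok (snd s')" "input_ok (snd s')" "fst s' rQ = q"
      using inv by (simp_all add: I_def)
    show "2 ^ (n * \<Delta>) \<le> q" "q < (T + 1) * 2 ^ (n * \<Delta>)"
      using q by (simp_all add: R_def)
    show "snd s' (tab_base + p) = table (p div 2 ^ (n * \<Delta>)) (p mod 2 ^ (n * \<Delta>))" if "p < q" for p
      using inv that by (simp add: I_def table_filled_def)
  next
    fix u s''
    assume u: "u \<le> 20 * 2 ^ n + 36 * n + m * (35 + 100 * \<Delta>) + 85"
      and un: "unchanged step_regs s' s''"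
      and mem'': "snd s'' = (snd s')(tab_base + q := table (q div 2 ^ (n * \<Delta>)) (q mod 2 ^ (n * \<Delta>)))"
    note ok = inv[unfolded I_def]
    have below: "snd s'' a = snd s' a" if "a < tab_base" for a
      using that by (simp add: mem'')
    have "powers_ok (snd s'')"
      by (rule powers_ok_upd[of "snd s'"]) (use ok act_less_tab below in simp_all)
    moreover have "labels_ok (snd s'')"
      by (rule labels_ok_upd[of "snd s'"]) (use ok below in simp_all)
    moreover have "input_ok (snd s'')"
      by (rule input_ok_upd[of "snd s'"]) (use ok act_less_tab below in \<open>simp_all add: act_base_eq\<close>)
    moreover have "table_filled (Suc q) (snd s'')"
      using ok by (simp add: table_filled_def mem'' less_Suc_eq)
    ultimately show "u \<le> 20 * 2 ^ n + 36 * n + m * (35 + 100 * \<Delta>) + 85 \<and> fst s'' rQ = q \<and>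
        I (Suc q) ((fst s'')(rQ := Suc q), snd s'')"
      using u un ok by (simp add: I_def unchanged_def)
  qed
  have pow: "snd s (pow_base + n * \<Delta>) = R" "snd s (pow_base + n) = 2 ^ n"
    using mem(1) n_le by (simp_all add: powers_ok_def R_def)
  have keep: "R div 2 ^ n = 2 ^ (n * \<Delta> - n)"
    using n_le by (simp add: R_def power_diff)
  have "T * 1 \<le> T * m"
    using edges_pos by (intro mult_le_mono2) simp
  moreover have "tab_base + (T * R + R) \<le> 2 ^ w"
    using tab_bound by (simp add: R_def add.commute)
  \<comment> \<open>As \<open>T\<close> is at least 1, \<open>value_bound\<close> also covers the
    constant in \<open>rBig\<close>.\<close>
  moreover have "1 * (n + (n * T + 1)) \<le> T * (n + (n * T + 1))"
    using Delta_pos Delta_le by (intro mult_le_mono1) simp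
  then have "n + (n * T + 1) < 2 ^ w"
    using value_bound by simp
  then have "Suc (n * T) < 2 ^ w"
    by simp
  moreover have "tab_base = act_base + (m + T * m)"
    by (simp add: tab_base_def)
  ultimately have b: "Suc T < 2 ^ w" "m + T * m < 2 ^ w" "act_base + (m + T * m) < 2 ^ w"
      "pow_base + n * \<Delta> < 2 ^ w" "pow_base + n < 2 ^ w" "n * T < 2 ^ w" "Suc (n * T) < 2 ^ w"
      "R + T * R < 2 ^ w" "Suc 0 < 2 ^ w"
    using tab_less pow_base_ge n_le edges_pos unfolding act_base_eq by linarith+
  show ?thesis
    unfolding fill_table_def
    apply (intro wp_SeqI wp_SetRegI)
           apply (use b in \<open>simp_all add: regs pow keep\<close>)
    apply (rule wp_forI[where I = I and lo = R and hi = "(T + 1) * R" and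
          k = "20 * 2 ^ n + 36 * n + m * (35 + 100 * \<Delta>) + 85"])
         apply (use b in simp)
    subgoal using init by (simp add: F_def tab_base_def)
       apply simp
    subgoal for q s'
      by (simp add: I_def unchanged_def F_def)
     apply (rule body; simp)
    subgoal for u s'
      apply (rule post)
        apply (simp add: R_def ac_simps)
       apply (rule regs', assumption)
      apply (simp add: I_def R_def)
      done
    done
qed


section \<open>Preparing the memory: end of the input, powers of two, label flags\<close>

lemma wp_read_size:
  assumes head: "snd s 0 = n" "snd s 1 = m" "snd s 2 = \<Delta>" and mem: "input_ok (snd s)"
    and post: "\<And>u s'. u \<le> m * 17 + 30 \<Longrightarrow> snd s' = snd s \<Longrightarrow> fst s' rN = n \<Longrightarrow> fst s' rM = m \<Longrightarrow>
      fst s' rDelta = \<Delta> \<Longrightarrow> fst s' rPos = pow_base \<Longrightarrow> Q u s'"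
  shows "wp w read_size Q s"
proof -
  define I where "I e s' \<longleftrightarrow> snd s' = snd s \<and> fst s' rN = n \<and> fst s' rM = m \<and> fst s' rDelta = \<Delta> \<and>
    fst s' rEdge = e \<and> fst s' rPos = pos e" for e s'
  have small: "3 < (2::nat) ^ w"
    using tab_less act_less_tab pow_base_ge unfolding act_base_eq by linarith
  have m: "m < 2 ^ w"
    using tab_less by (simp add: tab_base_def)
  have body: "wp w (SetReg rPos (Op Add (Op Add (Reg rPos) (Const 3)) (Load (Op Add (Reg rPos) (Const 2)))))
      (\<lambda>u s''. u \<le> 9 \<and> fst s'' rEdge = e \<and> I (Suc e) ((fst s'')(rEdge := Suc e), snd s'')) s'"
    if e: "e < m" and inv: "I e s'" for e s'
  proof -
    have len: "snd s (pos e + 2) = length (labels e)"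
      using mem e by (simp add: input_ok_def)
    have "pos e + 3 + length (labels e) < 2 ^ w"
      using tab_less act_less_tab pos_bound[OF e] unfolding act_base_eq by linarith
    then show ?thesis
      using inv[unfolded I_def] len small pos_Suc[OF e]
      by (intro wp_SetRegI) (simp_all add: I_def)
  qed
  show ?thesis
    unfolding read_size_def
    apply (intro wp_SeqI wp_SetRegI)
          apply (use small head in simp_all)
    apply (rule wp_forI[where I = I and lo = 0 and hi = m and k = 9])
         apply (rule m)
        apply (simp add: I_def pos_0)
       apply simp
      apply (simp add: I_def)
     apply (rule body; simp)
    subgoal for u s'
      by (rule post) (simp_all add: I_def pow_base_def)
    done
qed

lemma wp_make_powers:
  assumes regs: "fst s rN = n" "fst s rM = m" "fst s rDelta = \<Delta>" "fst s rPos = pow_base"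
    and post: "\<And>u s'. u \<le> (n * \<Delta> + 1) * 17 + 30 \<Longrightarrow> powers_ok (snd s') \<Longrightarrow>
      (\<And>a. a < pow_base \<or> act_base \<le> a \<Longrightarrow> snd s' a = snd s a) \<Longrightarrow>
      fst s' rN = n \<Longrightarrow> fst s' rM = m \<Longrightarrow> fst s' rDelta = \<Delta> \<Longrightarrow> fst s' rPow = pow_base \<Longrightarrow>
      fst s' rBits = n * \<Delta> \<Longrightarrow> fst s' rLim = n * \<Delta> + 1 \<Longrightarrow> Q u s'"
  shows "wp w make_powers Q s"
proof -
  define I where "I i s' \<longleftrightarrow> fst s' rN = n \<and> fst s' rM = m \<and> fst s' rDelta = \<Delta> \<and>
    fst s' rPow = pow_base \<and> fst s' rBits = n * \<Delta> \<and> fst s' rLim = n * \<Delta> + 1 \<and>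
    fst s' rI = i \<and> fst s' rX = 2 ^ i \<and>
    snd s' = (\<lambda>a. if pow_base \<le> a \<and> a < pow_base + i then 2 ^ (a - pow_base) else snd s a)" for i s'
  have small: "1 < (2::nat) ^ w" "n * \<Delta> + 1 < 2 ^ w" "pow_base + n * \<Delta> < 2 ^ w"
    using tab_less act_less_tab pow_base_ge unfolding act_base_eq by linarith+
  have body: "wp w (Seq (Store (Op Add (Reg rPow) (Reg rI)) (Reg rX)) (SetReg rX (Op Add (Reg rX) (Reg rX))))
      (\<lambda>u s''. u \<le> 9 \<and> fst s'' rI = i \<and> I (Suc i) ((fst s'')(rI := Suc i), snd s'')) s'"
    if i: "i < n * \<Delta> + 1" and inv: "I i s'" for i s'
  proof -
    have "(2::nat) ^ i \<le> 2 ^ (n * \<Delta>)"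
      using i by (intro power_increasing) simp_all
    \<comment> \<open>After storing \<open>2 ^ (n * \<Delta>)\<close> the loop doubles
      \<open>rX\<close> once more; the result still fits because the table has at least two
      rows.\<close>
    moreover have "2 * (2::nat) ^ (n * \<Delta>) \<le> (T + 1) * 2 ^ (n * \<Delta>)"
      using Delta_pos Delta_le by (intro mult_le_mono1) simp
    ultimately have x: "2 ^ i + 2 ^ i < (2::nat) ^ w"
      using tab_bound act_less_tab by linarith
    have addr: "pow_base + i < 2 ^ w"
      using i small by simp
    have mem: "(snd s')(pow_base + i := 2 ^ i) =
        (\<lambda>a. if pow_base \<le> a \<and> a < pow_base + Suc i then 2 ^ (a - pow_base) else snd s a)"
      using inv unfolding I_def by (auto simp: fun_eq_iff less_Suc_eq)
    show ?thesis
      using inv[unfolded I_def] x addr mem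
      apply (intro wp_SeqI wp_SetRegI wp_StoreI)
         apply simp
        apply simp
       apply simp
      by (simp add: I_def mult_2)
  qed
  show ?thesis
    unfolding make_powers_def
    apply (intro wp_SeqI wp_SetRegI)
         apply (use small regs in simp_all)
    apply (rule wp_forI[where I = I and lo = 0 and hi = "n * \<Delta> + 1" and k = 9])
         apply (rule small)
        apply (simp add: I_def fun_eq_iff)
       apply simp
      apply (simp add: I_def)
     apply (rule body; simp)
    subgoal for u s'
      by (rule post) (auto simp: I_def powers_ok_def act_base_eq)
    done
qed

text \<open>All flags are written with the same value 1, so the memory depends only on the set of
  cells written, not on the order of the labels.\<close>

definition mark :: "nat set \<Rightarrow> (nat \<Rightarrow> nat) \<Rightarrow> nat \<Rightarrow> nat" where
  "mark X \<mu> = (\<lambda>a. if a \<in> X then 1 else \<mu> a)"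

lemma mark_upd: "(mark X \<mu>)(a := Suc 0) = mark (insert a X) \<mu>"
  by (auto simp: mark_def)

definition label_marks :: "nat \<Rightarrow> nat set" where
  "label_marks e = {act_base + (l * m + d) |d l. d < e \<and> l \<in> set (labels d)}"

lemma label_marks_Suc:
  "label_marks (Suc e) = label_marks e \<union> (\<lambda>i. act_base + (labels e ! i * m + e)) ` {..<length (labels e)}"
  by (fastforce simp: label_marks_def less_Suc_eq in_set_conv_nth)

lemma label_marks_bounds:
  assumes "a \<in> label_marks m"
  shows "act_base \<le> a" "a < tab_base"
  using assms act_addr_less label_le by (auto simp: label_marks_def)

lemma mark_outside:
  "a < act_base \<or> tab_base \<le> a \<Longrightarrow> mark (label_marks m) \<mu> a = \<mu> a"
  using label_marks_bounds[of a] by (auto simp: mark_def)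

text \<open>Quotient and remainder modulo \<open>m\<close> recover label and edge from a cell, so no
  flag is raised on behalf of another pair.\<close>

lemma labels_ok_mark:
  assumes zero: "\<And>a. act_base \<le> a \<Longrightarrow> \<mu> a = 0"
  shows "labels_ok (mark (label_marks m) \<mu>)"
proof -
  have "act_base + (t * m + e) \<in> label_marks m \<longleftrightarrow> t \<in> set (labels e)" if e: "e < m" for e t
  proof
    assume "act_base + (t * m + e) \<in> label_marks m"
    then obtain d l where d: "d < m" "l \<in> set (labels d)" "t * m + e = l * m + d"
      by (auto simp: label_marks_def)
    have "t = l" "e = d"
      using arg_cong[OF d(3), of "\<lambda>x. x div m"] arg_cong[OF d(3), of "\<lambda>x. x mod m"] d(1) e
      by simp_all
    then show "t \<in> set (labels e)"
      using d(2) by simp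
  qed (use e in \<open>auto simp: label_marks_def\<close>)
  then show ?thesis
    by (simp add: labels_ok_def mark_def zero)
qed

text \<open>\<open>rT\<close> is described by three properties that accumulate over the edges: it
  never decreases, stays at most \<open>T\<close>, and dominates the labels just read.\<close>

lemma wp_read_edge:
  assumes regs: "fst s rM = m" "fst s rAct = act_base" "fst s rEdge = e" "fst s rPos = pos e"
    and e: "e < m" and rT: "fst s rT \<le> T"
    and mem: "snd s = mark (label_marks e) \<mu>" "input_ok \<mu>"
    and post: "\<And>u s'. u \<le> T * 30 + 30 \<Longrightarrow> unchanged {rLen, rPos, rI, rX, rT} s s' \<Longrightarrow>
      fst s' rPos = pos (Suc e) \<Longrightarrow> fst s rT \<le> fst s' rT \<Longrightarrow> fst s' rT \<le> T \<Longrightarrow>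
      (\<forall>l\<in>set (labels e). l \<le> fst s' rT) \<Longrightarrow> snd s' = mark (label_marks (Suc e)) \<mu> \<Longrightarrow> Q u s'"
  shows "wp w read_edge Q s"
proof -
  define L where "L = length (labels e)"
  define X where "X i = label_marks e \<union> (\<lambda>i. act_base + (labels e ! i * m + e)) ` {..<i}" for i
  define I where "I i s' \<longleftrightarrow> unchanged {rLen, rPos, rI, rX, rT} s s' \<and> fst s' rLen = L \<and>
    fst s' rPos = pos e + 3 \<and> fst s' rI = i \<and> fst s rT \<le> fst s' rT \<and> fst s' rT \<le> T \<and>
    (\<forall>j<i. labels e ! j \<le> fst s' rT) \<and> snd s' = mark (X i) \<mu>" for i s'
  \<comment> \<open>Flags lie behind the input, so the records can still be read while flags are
    being written.\<close>
  have low: "mark Y \<mu> a = \<mu> a" if "a < act_base" "\<And>b. b \<in> Y \<Longrightarrow> act_base \<le> b" for a Y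
    using that(1) that(2)[of a] by (auto simp: mark_def)
  have X_ge: "act_base \<le> b" if "b \<in> X i" for b i
    using that by (auto simp: X_def label_marks_def)
  have marks_ge: "act_base \<le> b" if "b \<in> label_marks e" for b
    using that by (auto simp: label_marks_def)
  have pe: "pos e + 3 + L \<le> pow_base"
    using pos_bound[OF e] by (simp add: L_def)
  have pb: "pow_base < 2 ^ w" "pow_base < act_base"
    using tab_less act_less_tab unfolding act_base_eq by linarith+
  have len: "snd s (pos e + 2) = L"
    using mem pe pb e low[of "pos e + 2", OF _ marks_ge] by (simp add: input_ok_def L_def)
  have L: "L \<le> T"
    using length_labels_le[OF e] by (simp add: L_def)
  have body: "wp w
      (Seq (SetReg rX (Load (Op Add (Reg rPos) (Reg rI))))
      (Seq (Store (Op Add (Reg rAct) (Op Add (Op Mul (Reg rX) (Reg rM)) (Reg rEdge))) (Const 1))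
        (Cond (Op Less (Reg rT) (Reg rX)) (SetReg rT (Reg rX)) Skip)))
      (\<lambda>u s''. u \<le> 22 \<and> fst s'' rI = i \<and> I (Suc i) ((fst s'')(rI := Suc i), snd s'')) s'"
    if i: "i < L" and inv: "I i s'" for i s'
  proof -
    have "mark (X i) \<mu> (pos e + 3 + i) = labels e ! i"
      using mem(2) e i pe pb low[of "pos e + 3 + i", OF _ X_ge] by (simp add: input_ok_def L_def)
    then have x: "snd s' (pos e + 3 + i) = labels e ! i"
      using inv by (simp add: I_def)
    have l: "labels e ! i \<le> T"
      using label_le[OF e] i by (simp add: L_def)
    have b: "labels e ! i * m + e < 2 ^ w" "act_base + (labels e ! i * m + e) < 2 ^ w"
      "pos e + 3 + i < 2 ^ w" "1 < (2::nat) ^ w"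
      using act_addr_less[OF e l] tab_less pe pb pow_base_ge i by linarith+
    have XS: "X (Suc i) = insert (act_base + (labels e ! i * m + e)) (X i)"
      by (auto simp: X_def less_Suc_eq)
    have u: "fst s' rM = m" "fst s' rAct = act_base" "fst s' rEdge = e"
      using inv regs by (simp_all add: I_def unchanged_def)
    note inv' = inv[unfolded I_def]
    show ?thesis
      apply (intro wp_intros)
           apply (use inv' u x b in simp_all)
      subgoal
        using l by (simp add: I_def unchanged_def mark_upd XS All_less_Suc) 
          (meson less_imp_le order_trans)
      subgoal
        by (simp add: I_def unchanged_def mark_upd XS All_less_Suc)
      done
  qed
  show ?thesis
    unfolding read_edge_def
    apply (intro wp_SeqI wp_SetRegI)
       apply (use regs len pe pb pow_base_ge in simp_all)
    apply (rule wp_forI[where I = I and lo = 0 and hi = L and k = 22])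
         apply (use L tab_less pe pb in simp)
        apply (simp add: I_def unchanged_def X_def mem rT)
       apply simp
      apply (simp add: I_def)
     apply (rule body[simplified]; simp)
    apply (rule wp_SetRegI)
     apply (use pe pb in \<open>simp add: I_def\<close>)
    apply (rule post)
          apply (use L in \<open>simp\<close>)
         apply (simp_all add: I_def unchanged_def pos_Suc[OF e] L_def X_def label_marks_Suc all_set_conv_all_nth)
    done
qed

lemma wp_read_labels:
  assumes regs: "fst s rN = n" "fst s rM = m" "fst s rDelta = \<Delta>" "fst s rPow = pow_base"
      "fst s rBits = n * \<Delta>" "fst s rLim = n * \<Delta> + 1"
    and mem: "input_ok (snd s)"
    and post: "\<And>u s'. u \<le> m * (T * 30 + 40) + 20 \<Longrightarrow> fst s' rN = n \<Longrightarrow> fst s' rM = m \<Longrightarrow>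
      fst s' rDelta = \<Delta> \<Longrightarrow> fst s' rPow = pow_base \<Longrightarrow> fst s' rAct = act_base \<Longrightarrow> fst s' rT = T \<Longrightarrow>
      fst s' rBits = n * \<Delta> \<Longrightarrow> snd s' = mark (label_marks m) (snd s) \<Longrightarrow> Q u s'"
  shows "wp w read_labels Q s"
proof -
  define I where "I e s' \<longleftrightarrow> fst s' rN = n \<and> fst s' rM = m \<and> fst s' rDelta = \<Delta> \<and> fst s' rPow = pow_base \<and>
    fst s' rAct = act_base \<and> fst s' rBits = n * \<Delta> \<and> fst s' rEdge = e \<and> fst s' rPos = pos e \<and>
    fst s' rT \<le> T \<and> (\<forall>d<e. \<forall>l\<in>set (labels d). l \<le> fst s' rT) \<and>
    snd s' = mark (label_marks e) (snd s)" for e s'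
  have "m \<le> tab_base"
    by (simp add: tab_base_def)
  then have small: "3 < (2::nat) ^ w" "m < 2 ^ w" "act_base < 2 ^ w"
    using tab_less act_less_tab pow_base_ge unfolding act_base_eq by linarith+
  have body: "wp w read_edge
      (\<lambda>u s''. u \<le> T * 30 + 30 \<and> fst s'' rEdge = e \<and> I (Suc e) ((fst s'')(rEdge := Suc e), snd s'')) s'"
    if e: "e < m" and inv: "I e s'" for e s'
  proof -
    note inv' = inv[unfolded I_def]
    show ?thesis
      apply (rule wp_read_edge[of s' e "snd s"])
              apply (use inv' e mem in simp_all)
      apply (simp add: I_def unchanged_def All_less_Suc)
      apply (blast intro: order_trans)
      done
  qed
  \<comment> \<open>\<open>rT\<close> is at most \<open>T\<close> and dominates all labels, one of
    which is \<open>T\<close>.\<close>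
  have T: "fst s' rT = T" if "I m s'" for s'
    using that T_attained unfolding I_def by (meson antisym)
  show ?thesis
    unfolding read_labels_def
    apply (intro wp_SeqI wp_SetRegI)
        apply (use small regs in \<open>simp_all add: act_base_eq\<close>)
    apply (rule wp_forI[where I = I and lo = 0 and hi = m and k = "T * 30 + 30"])
         apply simp
        apply (simp add: I_def pos_0 act_base_eq label_marks_def mark_def)
       apply simp
      apply (simp add: I_def)
     apply (rule body; simp)
    subgoal premises prems for u s'
      using prems(10,11) T[OF prems(11)] unfolding I_def
      by (intro post) (simp_all add: algebra_simps)
    done
qed

text \<open>The areas are written in order of increasing addresses, so each phase still finds zeros
  in the area that it is about to use.\<close>

lemma wp_tvc_com:
  assumes head: "snd s 0 = n" "snd s 1 = m" "snd s 2 = \<Delta>" and mem: "input_ok (snd s)"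
    and zero: "\<And>a. pow_base \<le> a \<Longrightarrow> snd s a = 0"
  shows "wp w tvc_com (\<lambda>u s'. u \<le> m * 17 + (n * \<Delta> + 1) * 17 + m * (T * 30 + 40)
      + T * 2 ^ (n * \<Delta>) * (20 * 2 ^ n + 36 * n + m * (35 + 100 * \<Delta>) + 93) + 20 * 2 ^ (n * \<Delta>) + 150 \<and>
    fst s' rRes = Min (table T ` {..<2 ^ (n * \<Delta>)})) s"
  unfolding tvc_com_def
  apply (intro wp_SeqI)
  apply (rule wp_read_size[OF head mem])
  apply (intro wp_SeqI)
  apply (rule wp_make_powers, assumption+)
  subgoal for u1 s1 u2 s2
    apply (intro wp_SeqI)
    apply (rule wp_read_labels, assumption+)
     apply (rule input_ok_upd[OF mem])
     apply simp
    subgoal premises prems for u3 s3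
    proof -
      have below: "snd s2 a = snd s a" if "a < pow_base \<or> act_base \<le> a" for a
        using prems(2,9) that by simp
      have pow: "powers_ok (snd s3)"
        unfolding prems(24)
        by (rule powers_ok_upd[OF prems(8)]) (simp add: mark_outside)
      have lab: "labels_ok (snd s3)"
        unfolding prems(24)
        by (rule labels_ok_mark) (simp add: below zero act_base_eq)
      have inp: "input_ok (snd s3)"
        unfolding prems(24)
        by (rule input_ok_upd[OF mem]) (simp add: mark_outside below act_base_eq)
      have zero': "snd s3 a = 0" if "tab_base \<le> a" for a
        using that act_less_tab unfolding prems(24)
        by (simp add: mark_outside below zero act_base_eq)
      show ?thesis
      proof (rule wp_SeqI, rule wp_fill_table[OF prems(17-23) pow lab inp zero'])
        fix u4 s4
        assume u4: "u4 \<le> T * 2 ^ (n * \<Delta>) * (20 * 2 ^ n + 36 * n + m * (35 + 100 * \<Delta>) + 93) + 50"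
          and s4: "regs_ok (fst s4)" "table_filled ((T + 1) * 2 ^ (n * \<Delta>)) (snd s4)"
        show "wp w read_result (\<lambda>u s'. u1 + (u2 + (u3 + (u4 + u))) \<le> m * 17 + (n * \<Delta> + 1) * 17
            + m * (T * 30 + 40) + T * 2 ^ (n * \<Delta>) * (20 * 2 ^ n + 36 * n + m * (35 + 100 * \<Delta>) + 93)
            + 20 * 2 ^ (n * \<Delta>) + 150 \<and> fst s' rRes = Min (table T ` {..<2 ^ (n * \<Delta>)})) s4"
          by (rule wp_read_result[OF s4]) (use prems(1,7,16) u4 in linarith)
      qed
    qed
    done
  done

end


section \<open>Covers as paths of masks\<close>

context tvc_instance
begin

text \<open>Consecutive windows overlap in \<open>\<Delta> - 1\<close> layers, on which their masks agree.\<close>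

definition mask_path :: "nat \<Rightarrow> (nat \<Rightarrow> nat) \<Rightarrow> bool" where
  "mask_path t f \<longleftrightarrow> (\<forall>s\<le>t. f s < 2 ^ (n * \<Delta>)) \<and>
     (\<forall>s<t. f s div 2 ^ n = f (Suc s) mod 2 ^ (n * \<Delta> - n))"

text \<open>The start \<open>f 0\<close> is free of charge: none of its layers belongs to a time
  from 1 on.\<close>

definition path_cost :: "nat \<Rightarrow> (nat \<Rightarrow> nat) \<Rightarrow> nat" where
  "path_cost t f = (\<Sum>s<t. layer_count (f (Suc s)) + penalty (Suc s) (f (Suc s)))"

text \<open>The previous mask \<open>f t\<close> is the predecessor with
  \<open>y = f t mod 2 ^ n\<close>, so it takes part in the minimum.\<close>

lemma table_le_path_cost: "mask_path t f \<Longrightarrow> table t (f t) \<le> path_cost t f"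
proof (induction t)
  case (Suc t)
  have "mask_path t f"
    using Suc.prems by (simp add: mask_path_def)
  then have IH: "table t (f t) \<le> path_cost t f"
    by (rule Suc.IH)
  have "f (Suc t) mod 2 ^ (n * \<Delta> - n) = f t div 2 ^ n"
    using Suc.prems by (simp add: mask_path_def)
  then have "f (Suc t) mod 2 ^ (n * \<Delta> - n) * 2 ^ n + f t mod 2 ^ n = f t"
    by (simp only: div_mult_mod_eq)
  then have "Min ((\<lambda>y. table t (f (Suc t) mod 2 ^ (n * \<Delta> - n) * 2 ^ n + y)) ` {..<2 ^ n}) \<le> table t (f t)"
    by (intro Min_le) (auto intro!: image_eqI[of _ _ "f t mod 2 ^ n"])
  then show ?case
    using IH by (simp add: path_cost_def)
qed simp

text \<open>Following a minimizing predecessor backwards in time builds the path.\<close>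

lemma table_eq_path_cost:
  assumes "0 < \<Delta>" "M < 2 ^ (n * \<Delta>)"
  shows "\<exists>f. mask_path t f \<and> f t = M \<and> path_cost t f = table t M"
  using assms(2)
proof (induction t arbitrary: M)
  case 0
  then show ?case
    by (intro exI[of _ "\<lambda>_. M"]) (simp add: mask_path_def path_cost_def)
next
  case (Suc t)
  define R where "R = (2::nat) ^ (n * \<Delta>)"
  define S where "S = (2::nat) ^ (n * \<Delta> - n)"
  define K where "K = (2::nat) ^ n"
  have "n \<le> n * \<Delta>"
    using assms(1) by simp
  then have RSK: "R = S * K"
    unfolding R_def S_def K_def power_add[symmetric] by simp
  have pos: "0 < S" "0 < K"
    by (simp_all add: S_def K_def)
  let ?A = "(\<lambda>y. table t (M mod S * K + y)) ` {..<K}"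
  have "Min ?A \<in> ?A"
    using pos by (intro Min_in) (auto simp: lessThan_empty_iff)
  then obtain y where y: "y < K" "Min ?A = table t (M mod S * K + y)"
    by auto
  have "M mod S * K + K \<le> S * K"
    using pos mult_le_mono1[of "Suc (M mod S)" S K] by (simp add: Suc_le_eq)
  then have "M mod S * K + y < R"
    using y(1) RSK by simp
  then obtain g where g: "mask_path t g" "g t = M mod S * K + y" "path_cost t g = Min ?A"
    using Suc.IH[of "M mod S * K + y"] y(2) by (auto simp: R_def)
  \<comment> \<open>The values of \<open>g\<close> up to \<open>t\<close>, and with them the cost so
    far, remain.\<close>
  let ?f = "g(Suc t := M)"
  have "path_cost t ?f = path_cost t g"
    by (simp add: path_cost_def)
  then have "path_cost (Suc t) ?f = table (Suc t) M"
    using g(3) by (simp add: path_cost_def S_def K_def)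
  moreover have "mask_path (Suc t) ?f"
    using g(1,2) Suc.prems y(1) pos
    by (auto simp: mask_path_def less_Suc_eq le_Suc_eq S_def[symmetric] K_def[symmetric])
  moreover have "?f (Suc t) = M"
    by simp
  ultimately show ?case
    by blast
qed

end

section \<open>Correspondence between mask paths and vertex covers, independent of the
  machine\<close>

locale tvc_encoding = tvc_instance +
  fixes V :: "'v set" and E :: "'v set set" and lam :: "'v set \<Rightarrow> nat set" and vs :: "'v list"
  assumes distinct_vs: "distinct vs" and set_vs: "set vs = V" and length_vs: "length vs = n"
    and E_eq: "E = (\<lambda>e. {vs ! src e, vs ! trg e}) ` {..<m}"
    and lam_eq: "e < m \<Longrightarrow> lam {vs ! src e, vs ! trg e} = set (labels e)"
    and src_less: "e < m \<Longrightarrow> src e < n" and trg_less: "e < m \<Longrightarrow> trg e < n"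
    and n_pos: "0 < n" and Delta_pos: "0 < \<Delta>" and Delta_le: "\<Delta> \<le> T"
    and lifetime_eq: "lifetime E lam = T"
begin

text \<open>The guard restricts to appearances from time 1 on, where the subtraction does not
  truncate. Bits for earlier times stay arbitrary, because a path may start in any mask.\<close>

definition represents :: "(nat \<Rightarrow> nat) \<Rightarrow> ('v \<times> nat) set \<Rightarrow> bool" where
  "represents f S \<longleftrightarrow> (\<forall>t\<le>T. \<forall>i<\<Delta>. \<forall>v<n. \<Delta> < t + 1 + i \<longrightarrow>
     (bit (f t) (n * i + v) \<longleftrightarrow> (vs ! v, t + 1 + i - \<Delta>) \<in> S))"

lemma top_layer: "n * (\<Delta> - 1) = n * \<Delta> - n"
  by (simp add: diff_mult_distrib2)

lemma represents_layer:
  assumes "represents f S" "1 \<le> t" "t \<le> T" "v < n"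
  shows "bit (f t) (n * \<Delta> - n + v) \<longleftrightarrow> (vs ! v, t) \<in> S"
proof -
  have "bit (f t) (n * (\<Delta> - 1) + v) \<longleftrightarrow> (vs ! v, t + 1 + (\<Delta> - 1) - \<Delta>) \<in> S"
    using assms(1)[unfolded represents_def, rule_format, of t "\<Delta> - 1" v] assms(2-4) Delta_pos by simp
  moreover have "t + 1 + (\<Delta> - 1) - \<Delta> = t"
    using Delta_pos by simp
  ultimately show ?thesis
    by (simp only: top_layer)
qed

text \<open>An appearance occurs in up to \<open>\<Delta>\<close> masks but is in the newest layer
  exactly once, at its own time.\<close>

lemma represents_card:
  assumes "represents f S" "S \<subseteq> V \<times> {1..T}"
  shows "card S = (\<Sum>s<T. layer_count (f (Suc s)))"
proof -
  let ?B = "\<lambda>s. {v. v < n \<and> (vs ! v, Suc s) \<in> S}"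
  have "S = (\<lambda>(s, v). (vs ! v, Suc s)) ` (SIGMA s:{..<T}. ?B s)"
  proof (intro equalityI subsetI)
    fix a assume a: "a \<in> S"
    then obtain x t where xt: "a = (x, t)" "x \<in> V" "1 \<le> t" "t \<le> T"
      using assms(2) by auto
    then obtain v where "v < n" "x = vs ! v"
      using set_vs length_vs by (metis in_set_conv_nth)
    then show "a \<in> (\<lambda>(s, v). (vs ! v, Suc s)) ` (SIGMA s:{..<T}. ?B s)"
      using a xt by (intro image_eqI[of _ _ "(t - 1, v)"]) auto
  qed auto
  then have "card S = card ((\<lambda>(s, v). (vs ! v, Suc s)) ` (SIGMA s:{..<T}. ?B s))"
    by (rule arg_cong)
  moreover have "inj_on (\<lambda>(s, v). (vs ! v, Suc s)) (SIGMA s:{..<T}. ?B s)"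
    using distinct_vs length_vs by (auto simp: inj_on_def nth_eq_iff_index_eq)
  ultimately have "card S = (\<Sum>s<T. card (?B s))"
    by (simp add: card_image)
  moreover have "card (?B s) = layer_count (f (Suc s))" if "s < T" for s
  proof -
    have "layer_count (f (Suc s)) = card {v \<in> {..<n}. bit (f (Suc s)) (n * \<Delta> - n + v)}"
      by (simp add: layer_count_def of_bool_def sum.If_cases Int_def)
    also have "{v \<in> {..<n}. bit (f (Suc s)) (n * \<Delta> - n + v)} = ?B s"
      using represents_layer[OF assms(1), of "Suc s"] that by auto
    finally show ?thesis ..
  qed
  ultimately show ?thesis
    by simp
qed

definition window_covered :: "('v \<times> nat) set \<Rightarrow> nat \<Rightarrow> bool" where
  "window_covered S t \<longleftrightarrow> (\<forall>e\<in>window_edges E lam \<Delta> t. \<exists>a\<in>S. snd a \<in> window \<Delta> t \<and> temporally_covers lam a e)"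

lemma window_iff: "x \<in> window \<Delta> t \<longleftrightarrow> (\<exists>i<\<Delta>. x = t + i)"
  unfolding window_def by (auto simp: nat_le_iff_add)

text \<open>For \<open>\<Delta> \<le> t\<close> the window starts at time 1 or later, so the guard
  in \<open>represents\<close> holds for all its layers and every bit can be read as membership in
  \<open>S\<close>.\<close>

lemma represents_window:
  assumes "represents f S" "\<Delta> \<le> t" "t \<le> T"
  shows "window_ok t (f t) \<longleftrightarrow> window_covered S (t + 1 - \<Delta>)"
proof -
  let ?t = "t + 1 - \<Delta>"
  have edges: "window_edges E lam \<Delta> ?t =
      (\<lambda>e. {vs ! src e, vs ! trg e}) ` {e. e < m \<and> (\<exists>i<\<Delta>. ?t + i \<in> set (labels e))}"
  proof -
    have "window_edges E lam \<Delta> ?t = {e \<in> E. \<exists>i<\<Delta>. ?t + i \<in> lam e}"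
      unfolding window_edges_def snapshot_edges_def
      by (intro set_eqI) (simp add: Bex_def window_iff, blast)
    moreover have "{d \<in> f ` {..<m}. P d} = f ` {e. e < m \<and> P (f e)}" for f :: "nat \<Rightarrow> 'v set" and P
      by auto
    ultimately show ?thesis
      unfolding E_eq using lam_eq by (simp cong: conj_cong)
  qed
  have cov: "(\<exists>a\<in>S. snd a \<in> window \<Delta> ?t \<and> temporally_covers lam a {vs ! src e, vs ! trg e}) \<longleftrightarrow>
      (\<exists>i<\<Delta>. ?t + i \<in> set (labels e) \<and> (bit (f t) (n * i + src e) \<or> bit (f t) (n * i + trg e)))"
    if e: "e < m" for e
  proof -
    have "bit (f t) (n * i + src e) \<longleftrightarrow> (vs ! src e, ?t + i) \<in> S"
      "bit (f t) (n * i + trg e) \<longleftrightarrow> (vs ! trg e, ?t + i) \<in> S" if "i < \<Delta>" for i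
      using assms that src_less[OF e] trg_less[OF e] by (simp_all add: represents_def)
    then show ?thesis
      using lam_eq[OF e] unfolding temporally_covers_def Bex_def window_iff by force
  qed
  show ?thesis
    unfolding window_covered_def edges window_ok_def edge_ok_def using cov by auto
qed

text \<open>Windows are re-indexed by their last time, at which the table charges for them.\<close>

lemma sliding_window_tvc_iff:
  "sliding_window_tvc V E lam \<Delta> S \<longleftrightarrow>
     S \<subseteq> V \<times> {1..T} \<and> (\<forall>t. \<Delta> \<le> t \<and> t \<le> T \<longrightarrow> window_covered S (t + 1 - \<Delta>))"
proof -
  have "(\<forall>t\<in>{1..T - \<Delta> + 1}. window_covered S t) \<longleftrightarrow> (\<forall>t. \<Delta> \<le> t \<and> t \<le> T \<longrightarrow> window_covered S (t + 1 - \<Delta>))"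
  proof (intro iffI ballI allI impI)
    fix t assume "\<forall>t\<in>{1..T - \<Delta> + 1}. window_covered S t" "\<Delta> \<le> t \<and> t \<le> T"
    then show "window_covered S (t + 1 - \<Delta>)"
      by (auto elim!: ballE)
  next
    fix t assume "\<forall>t. \<Delta> \<le> t \<and> t \<le> T \<longrightarrow> window_covered S (t + 1 - \<Delta>)" "t \<in> {1..T - \<Delta> + 1}"
    moreover from this have "\<Delta> \<le> t + \<Delta> - 1 \<and> t + \<Delta> - 1 \<le> T" "(t + \<Delta> - 1) + 1 - \<Delta> = t"
      using Delta_pos Delta_le by auto
    ultimately show "window_covered S t"
      by metis
  qed
  then show ?thesis
    by (simp add: sliding_window_tvc_def lifetime_eq window_covered_def)
qed

lemma cover_path:
  assumes "S \<subseteq> V \<times> {1..T}"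
  shows "\<exists>f. mask_path T f \<and> represents f S"
proof -
  \<comment> \<open>Bit \<open>k\<close> is vertex \<open>k mod n\<close> in layer
    \<open>k div n\<close>. For times before 1 the truncated subtraction yields time 0, at which
    \<open>S\<close> has no appearance.\<close>
  define f where "f t = horner_sum of_bool (2::nat)
    (map (\<lambda>k. (vs ! (k mod n), t + 1 + k div n - \<Delta>) \<in> S) [0..<n * \<Delta>])" for t
  have bit_f: "bit (f t) k \<longleftrightarrow> k < n * \<Delta> \<and> (vs ! (k mod n), t + 1 + k div n - \<Delta>) \<in> S" for t k
    by (auto simp: f_def bit_horner_sum_bit_iff)
  have less: "f t < 2 ^ (n * \<Delta>)" for t
  proof -
    have "take_bit (n * \<Delta>) (f t) = f t"
      by (rule bit_eqI) (auto simp: bit_take_bit_iff bit_f)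
    then show ?thesis
      using take_bit_nat_less_exp by metis
  qed
  \<comment> \<open>Moving up by \<open>n\<close> bits enters the next layer, which offsets the
    reference time that is one smaller: both bits name the same appearance.\<close>
  have "(n + k) div n = Suc (k div n)" for k
    using div_add_self1[of n k] n_pos by simp
  then have "drop_bit n (f s) = take_bit (n * \<Delta> - n) (f (Suc s))" for s
    by (intro bit_eqI) (auto simp: bit_drop_bit_eq bit_take_bit_iff bit_f)
  then have "mask_path T f"
    using less by (simp add: mask_path_def drop_bit_eq_div take_bit_eq_mod)
  moreover have "represents f S"
  proof -
    have "n * i + v < n * \<Delta>" if "i < \<Delta>" "v < n" for i v
      using that mult_le_mono2[of "Suc i" \<Delta> n] by simp
    then show ?thesis
      by (simp add: represents_def bit_f)
  qed
  ultimately show ?thesis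
    by blast
qed

text \<open>The set is read off the newest layers alone; the older layers of each mask must then
  agree with it because consecutive masks overlap.\<close>

lemma path_cover:
  assumes "mask_path T f"
  shows "\<exists>S. S \<subseteq> V \<times> {1..T} \<and> represents f S"
proof -
  define S where "S = {(vs ! v, t) |v t. v < n \<and> t \<in> {1..T} \<and> bit (f t) (n * \<Delta> - n + v)}"
  have top: "bit (f t) (n * \<Delta> - n + v) \<longleftrightarrow> (vs ! v, t) \<in> S" if "v < n" "1 \<le> t" "t \<le> T" for v t
    using that distinct_vs length_vs by (auto simp: S_def nth_eq_iff_index_eq)
  have shift: "bit (f s) (n + k) \<longleftrightarrow> bit (f (Suc s)) k" if "s < T" "k < n * \<Delta> - n" for s k
  proof -
    have "drop_bit n (f s) = take_bit (n * \<Delta> - n) (f (Suc s))"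
      using assms that(1) by (simp add: mask_path_def drop_bit_eq_div take_bit_eq_mod)
    then have "bit (drop_bit n (f s)) k = bit (take_bit (n * \<Delta> - n) (f (Suc s))) k"
      by simp
    then show ?thesis
      using that(2) by (simp add: bit_drop_bit_eq bit_take_bit_iff)
  qed
  \<comment> \<open>\<open>j\<close> is the age of a layer. Going back one time moves it up by
    \<open>n\<close> bits, until at its own time it is on top.\<close>
  have rep: "bit (f t) (n * (\<Delta> - 1 - j) + v) \<longleftrightarrow> (vs ! v, t - j) \<in> S"
    if "j < \<Delta>" "j < t" "t \<le> T" "v < n" for t j v
    using that
  proof (induction j arbitrary: t)
    case 0
    then show ?case
      using top by (simp add: top_layer[symmetric])
  next
    case (Suc j)
    let ?k = "n * (\<Delta> - 1 - Suc j) + v"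
    have "n * (\<Delta> - 1 - j) = n + n * (\<Delta> - 1 - Suc j)"
      using Suc.prems(1) by (simp add: Suc_diff_Suc flip: mult_Suc_right)
    then have k: "n + ?k = n * (\<Delta> - 1 - j) + v"
      by simp
    have "n * (\<Delta> - 1 - j) \<le> n * (\<Delta> - 1)"
      by (intro mult_le_mono2) simp
    then have "?k < n * \<Delta> - n"
      using k Suc.prems(4) top_layer by linarith
    then have "bit (f t) ?k \<longleftrightarrow> bit (f (t - 1)) (n + ?k)"
      using shift[of "t - 1" ?k] Suc.prems by simp
    also have "\<dots> \<longleftrightarrow> (vs ! v, t - 1 - j) \<in> S"
      unfolding k using Suc.IH[of "t - 1"] Suc.prems by simp
    finally show ?case
      by simp
  qed
  have "represents f S"
    unfolding represents_def
  proof (intro allI impI)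
    fix t i v assume a: "t \<le> T" "i < \<Delta>" "v < n" "\<Delta> < t + 1 + i"
    then show "bit (f t) (n * i + v) \<longleftrightarrow> (vs ! v, t + 1 + i - \<Delta>) \<in> S"
      using rep[of "\<Delta> - 1 - i" t v] by (simp add: algebra_simps)
  qed
  moreover have "S \<subseteq> V \<times> {1..T}"
    using set_vs length_vs by (auto simp: S_def)
  ultimately show ?thesis
    by blast
qed

text \<open>A cover yields a path whose cost is its cardinality. Conversely, an optimal path is no
  more expensive than the full set of appearances, hence incurs no penalty and comes from a
  cover.\<close>

theorem Min_table: "Min (table T ` {..<2 ^ (n * \<Delta>)}) = min_sliding_window_tvc V E lam \<Delta>"
proof -
  let ?R = "2 ^ (n * \<Delta>) :: nat"
  let ?C = "{S. sliding_window_tvc V E lam \<Delta> S}"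
  have "finite V"
    using set_vs by auto
  then have "finite (Pow (V \<times> {1..T}))"
    by simp
  moreover have "?C \<subseteq> Pow (V \<times> {1..T})"
    by (auto simp: sliding_window_tvc_iff)
  ultimately have fin: "finite ?C"
    by (rule rev_finite_subset)
  have "window_covered (V \<times> {1..T}) (t + 1 - \<Delta>)" if t: "\<Delta> \<le> t" "t \<le> T" for t
    unfolding window_covered_def
  proof
    fix e assume "e \<in> window_edges E lam \<Delta> (t + 1 - \<Delta>)"
    then obtain i d where "i < \<Delta>" "d < m" "e = {vs ! src d, vs ! trg d}" "t + 1 - \<Delta> + i \<in> lam e"
      by (auto simp: window_edges_def snapshot_edges_def window_iff E_eq)
    moreover have "vs ! src d \<in> V"
      using src_less[OF \<open>d < m\<close>] set_vs length_vs by auto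
    ultimately show "\<exists>a\<in>V \<times> {1..T}. snd a \<in> window \<Delta> (t + 1 - \<Delta>) \<and> temporally_covers lam a e"
      using t by (intro bexI[of _ "(vs ! src d, t + 1 - \<Delta> + i)"])
        (auto simp: temporally_covers_def window_iff)
  qed
  \<comment> \<open>This makes the set of covers nonempty, so that its minimum is meaningful, and
    caps the optimum at \<open>n * T\<close>.\<close>
  then have full: "V \<times> {1..T} \<in> ?C"
    by (simp add: sliding_window_tvc_iff)
  have lower: "Min (table T ` {..<?R}) \<le> card S" if "S \<in> ?C" for S
  proof -
    have S: "S \<subseteq> V \<times> {1..T}" "\<And>t. \<Delta> \<le> t \<Longrightarrow> t \<le> T \<Longrightarrow> window_covered S (t + 1 - \<Delta>)"
      using that by (auto simp: sliding_window_tvc_iff)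
    obtain f where f: "mask_path T f" "represents f S"
      using cover_path[OF S(1)] by blast
    have "penalty (Suc s) (f (Suc s)) = 0" if "s < T" for s
      using represents_window[OF f(2), of "Suc s"] S(2)[of "Suc s"] that by (simp add: penalty_def)
    then have "path_cost T f = card S"
      using represents_card[OF f(2) S(1)] by (simp add: path_cost_def)
    moreover have "Min (table T ` {..<?R}) \<le> table T (f T)"
      using f(1) by (intro Min_le) (auto simp: mask_path_def)
    ultimately show ?thesis
      using table_le_path_cost[OF f(1)] by simp
  qed
  have upper: "Min (card ` ?C) \<le> Min (table T ` {..<?R})"
  proof -
    have "Min (table T ` {..<?R}) \<in> table T ` {..<?R}"
      by (intro Min_in) (auto simp: lessThan_empty_iff)
    then obtain M where M: "M < ?R" "table T M = Min (table T ` {..<?R})"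
      by auto
    obtain f where f: "mask_path T f" "path_cost T f = Min (table T ` {..<?R})"
      using table_eq_path_cost[OF Delta_pos M(1), of T] M(2) by auto
    obtain S where S: "S \<subseteq> V \<times> {1..T}" "represents f S"
      using path_cover[OF f(1)] by blast
    have "card V = n"
      using distinct_vs set_vs length_vs by (metis distinct_card)
    then have cost: "path_cost T f \<le> n * T"
      using lower[OF full] f(2) by (simp add: card_cartesian_product)
    have split: "path_cost T f = card S + (\<Sum>s<T. penalty (Suc s) (f (Suc s)))"
      using represents_card[OF S(2,1)] by (simp add: path_cost_def sum.distrib)
    have "window_covered S (t + 1 - \<Delta>)" if t: "\<Delta> \<le> t" "t \<le> T" for t
    proof -
      \<comment> \<open>One uncovered window would already contribute \<open>n * T + 1\<close>, more
        than the whole path costs.\<close>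
      have "penalty (Suc (t - 1)) (f (Suc (t - 1))) \<le> (\<Sum>s<T. penalty (Suc s) (f (Suc s)))"
        using t Delta_pos by (intro member_le_sum) auto
      then have "penalty t (f t) \<le> n * T"
        using t Delta_pos split cost by simp
      then have "window_ok t (f t)"
        using t by (auto simp: penalty_def split: if_splits)
      then show ?thesis
        using represents_window[OF S(2) t] by simp
    qed
    then have "S \<in> ?C"
      using S(1) by (simp add: sliding_window_tvc_iff)
    then have "Min (card ` ?C) \<le> card S"
      using fin by (intro Min_le) auto
    then show ?thesis
      using split f(2) by simp
  qed
  have "Min (table T ` {..<?R}) \<le> Min (card ` ?C)"
    using fin full lower by (subst Min_ge_iff) auto
  then show ?thesis
    using upper by (simp add: min_sliding_window_tvc_def)
qed

end


section \<open>Encoded instances\<close>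

lemma nth_concat_take:
  assumes "e < length xss" "i < length (xss ! e)"
  shows "concat xss ! (length (concat (take e xss)) + i) = xss ! e ! i"
    and "length (concat (take e xss)) + i < length (concat xss)"
proof -
  have split: "concat xss = concat (take e xss) @ xss ! e @ concat (drop (Suc e) xss)"
    using id_take_nth_drop[OF assms(1)] by (metis concat.simps(2) concat_append)
  show "concat xss ! (length (concat (take e xss)) + i) = xss ! e ! i"
    unfolding arg_cong[OF split, of "\<lambda>ys. ys ! (length (concat (take e xss)) + i)"]
    using assms(2) by (simp add: nth_append)
  show "length (concat (take e xss)) + i < length (concat xss)"
    unfolding arg_cong[OF split, of length] using assms(2) by simp
qed

text \<open>Every term of the running time and of the memory size is a product of some factors of
  \<open>N\<close>, up to constants. The one quadratic quantity is the bound on table entries, and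
  the third power of \<open>N\<close> absorbs it together with the constants.\<close>

lemma tvc_com_correct:
  fixes V :: "'v set" and E :: "'v set set" and lam :: "'v set \<Rightarrow> nat set" and \<Delta> w :: nat
  defines "n \<equiv> card V" and "m \<equiv> card E" and "T \<equiv> lifetime E lam"
  defines "N \<equiv> T * \<Delta> * (n + m) * 2 ^ (n * (\<Delta> + 1))"
  assumes graph: "temporal_graph V E lam" and Delta: "1 \<le> \<Delta>" "\<Delta> \<le> T"
    and enc: "encodes xs V E lam \<Delta>" and word: "N ^ 3 \<le> 2 ^ w"
  shows "wp w tvc_com (\<lambda>t s. t \<le> 600 * N \<and> fst s rRes = min_sliding_window_tvc V E lam \<Delta>)
    (initial_state xs)"
proof -
  obtain vs rs where vs: "distinct vs" "set vs = V"
    and distinct_rs: "distinct (map (\<lambda>(i, j, ls). {vs ! i, vs ! j}) rs)"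
    and set_rs: "set (map (\<lambda>(i, j, ls). {vs ! i, vs ! j}) rs) = E"
    and rs: "\<forall>(i, j, ls)\<in>set rs. i < length vs \<and> j < length vs \<and>
      distinct ls \<and> set ls = lam {vs ! i, vs ! j}"
    and xs: "xs = [length vs, length rs, \<Delta>] @ concat (map edge_record rs)"
    using enc unfolding encodes_def by blast
  define src where "src e = fst (rs ! e)" for e
  define trg where "trg e = fst (snd (rs ! e))" for e
  define labels where "labels e = snd (snd (rs ! e))" for e
  define pos where "pos e = 3 + length (concat (map edge_record (take e rs)))" for e
  have n: "length vs = n"
    using vs distinct_card unfolding n_def by metis
  have m: "length rs = m"
    using distinct_card[OF distinct_rs] set_rs by (simp add: m_def)
  have rs_nth: "rs ! e = (src e, trg e, labels e)" for e
    by (simp add: src_def trg_def labels_def)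
  have E_eq: "E = (\<lambda>e. {vs ! src e, vs ! trg e}) ` {..<m}"
    unfolding set_rs[symmetric] m[symmetric] set_map set_conv_nth[of rs]
    by (auto simp: image_iff rs_nth)
  have edge: "src e < n" "trg e < n" "distinct (labels e)" "set (labels e) = lam {vs ! src e, vs ! trg e}"
    if "e < m" for e
    using rs nth_mem[of e rs] that rs_nth[of e] by (auto simp: n m)
  have E_lam: "finite E" "\<forall>e\<in>E. finite (lam e) \<and> lam e \<noteq> {} \<and> 0 \<notin> lam e"
    using graph unfolding temporal_graph_def by (auto simp: E_eq)
  have fin: "finite (\<Union>e\<in>E. lam e)"
    using E_lam by auto
  have lab: "1 \<le> l" "l \<le> T" if "e < m" "l \<in> set (labels e)" for e l
  proof -
    have mem: "{vs ! src e, vs ! trg e} \<in> E" "l \<in> lam {vs ! src e, vs ! trg e}"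
      using that edge(4)[OF that(1)] by (auto simp: E_eq)
    then show "l \<le> T"
      unfolding T_def lifetime_def using fin by (intro Max_ge) auto
    show "1 \<le> l"
      using mem E_lam(2) by (metis One_nat_def Suc_leI gr0I)
  qed
  have T_attained: "\<exists>e<m. T \<in> set (labels e)"
  proof -
    have "T \<in> insert 0 (\<Union>e\<in>E. lam e)"
      unfolding T_def lifetime_def using fin by (intro Max_in) auto
    \<comment> \<open>\<open>T\<close> is positive, so the maximum is a label and not the default
      0.\<close>
    then obtain d where d: "d \<in> E" "T \<in> lam d"
      using Delta by auto
    then obtain e where "e < m" "d = {vs ! src e, vs ! trg e}"
      by (auto simp: E_eq)
    then show ?thesis
      using d(2) edge(4)[of e] by auto
  qed
  have len: "length (labels e) \<le> T" if "e < m" for e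
  proof -
    \<comment> \<open>Labels are positive, so there are at most \<open>T\<close> of them rather than
      \<open>T + 1\<close>.\<close>
    have "set (labels e) \<subseteq> {1..T}"
      using lab[OF that] by auto
    then have "card (set (labels e)) \<le> card {1..T}"
      by (intro card_mono) auto
    then show ?thesis
      using distinct_card[OF edge(3)[OF that]] by simp
  qed
  have n_pos: "2 \<le> n" and m_pos: "1 \<le> m"
  proof -
    obtain e where e: "e \<in> E"
      using T_attained E_eq by auto
    then have "e \<subseteq> V" "card e = 2" "finite V"
      using graph by (auto simp: temporal_graph_def)
    then show "2 \<le> n"
      unfolding n_def using card_mono by metis
    show "1 \<le> m"
      using T_attained by auto
  qed
  have pos_Suc: "pos (Suc e) = pos e + 3 + length (labels e)" if "e < m" for e
    using that by (simp add: pos_def take_Suc_conv_app_nth m rs_nth edge_record_def)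
  have pos_le: "e \<le> m \<Longrightarrow> pos e \<le> 3 + e * (3 + T)" for e
  proof (induction e)
    case (Suc e)
    then show ?case
      using pos_Suc[of e] len[of e] by simp
  qed (simp add: pos_def)
  define R where "R = (2::nat) ^ (n * \<Delta>)"
  define K where "K = (2::nat) ^ n"
  have N: "N = T * \<Delta> * (n + m) * (R * K)"
    by (simp add: N_def R_def K_def power_add[symmetric] algebra_simps)
  \<comment> \<open>Replacing the remaining factors by 1 will bound each partial product by
    \<open>N\<close>.\<close>
  have mono: "a * b * c * d \<le> N" if "a \<le> T" "b \<le> \<Delta>" "c \<le> n + m" "d \<le> R * K" for a b c d
    unfolding N using that by (intro mult_le_mono)
  have RK: "1 \<le> R" "1 \<le> K"
    by (simp_all add: R_def K_def)
  have RK': "1 \<le> R * K" "R \<le> R * K"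
    using RK by (simp_all add: Suc_le_eq)
  have T: "1 \<le> T"
    using Delta by simp
  have b: "m \<le> N" "n * \<Delta> \<le> N" "m * T \<le> N" "T * R * K \<le> N" "T * R * n \<le> N" "T * R * m \<le> N"
    "T * R * m * \<Delta> \<le> N" "T * R \<le> N" "R \<le> N" "n * T \<le> N" "T \<le> N"
    using mono[of 1 1 m 1] mono[of 1 \<Delta> n 1] mono[of T 1 m 1] mono[of T 1 1 "R * K"] mono[of T 1 n R]
      mono[of T 1 m R] mono[of T \<Delta> m R] mono[of T 1 1 R] mono[of 1 1 1 R] mono[of T 1 n 1] mono[of T 1 1 1]
      RK' T Delta n_pos m_pos by (simp_all add: ac_simps)
  have N16: "16 \<le> N"
  proof -
    have "2 \<le> n * \<Delta>"
      using n_pos Delta mult_le_mono[of 2 n 1 \<Delta>] by simp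
    then have "(2::nat) ^ 2 \<le> R" "(2::nat) ^ 2 \<le> K"
      unfolding R_def K_def using n_pos by (intro power_increasing; simp)+
    then have "4 * 4 \<le> R * K"
      by (intro mult_le_mono) simp_all
    then show ?thesis
      using mono[of 1 1 1 "R * K"] T Delta n_pos by simp
  qed
  have N2: "16 * N \<le> N * N" and N3: "16 * (N * N) \<le> N * (N * N)"
    using N16 by (auto intro: mult_le_mono1)
  have word': "N * (N * N) \<le> 2 ^ w"
    using word by (simp add: power3_eq_cube mult.assoc)
  interpret tvc_program n m \<Delta> T src trg labels w pos
  proof
    show "pos 0 = 3"
      by (simp add: pos_def)
    have "pos m \<le> 3 + 3 * m + m * T"
      using pos_le[of m] by (simp add: algebra_simps)
    moreover have "m * T + m = (T + 1) * m" "T * R + R = (T + 1) * R"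
      by simp_all
    ultimately show "pos m + n * \<Delta> + 1 + (T + 1) * m + (T + 1) * 2 ^ (n * \<Delta>) \<le> 2 ^ w"
      using b N16 N2 N3 word' unfolding R_def[symmetric] by linarith
    have "T * (n * T) \<le> N * N"
      using b by (intro mult_le_mono)
    moreover have "T * (n + (n * T + 1)) = n * T + T * (n * T) + T"
      by (simp add: algebra_simps)
    ultimately show "T * (n + (n * T + 1)) < 2 ^ w"
      using b N16 N2 N3 word' by linarith
  qed (use edge pos_Suc lab len T_attained Delta n_pos in auto)
  interpret tvc_encoding n m \<Delta> T src trg labels V E lam vs
    by standard (use vs n E_eq edge n_pos Delta in \<open>auto simp: T_def\<close>)
  have mem: "snd (initial_state xs) (3 + a) = concat (map edge_record rs) ! a"
    if "a < length (concat (map edge_record rs))" for a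
    using that by (simp add: initial_state_def xs)
  have inp: "input_ok (snd (initial_state xs))"
    unfolding input_ok_def
  proof (intro allI impI)
    fix e assume e: "e < m"
    have cell: "snd (initial_state xs) (pos e + i) = edge_record (rs ! e) ! i"
      if "i < length (edge_record (rs ! e))" for i
      using nth_concat_take[of e "map edge_record rs" i] mem e that
      by (simp add: pos_def m take_map add.assoc)
    have rec: "edge_record (rs ! e) = [src e, trg e, length (labels e)] @ labels e"
      by (simp add: edge_record_def rs_nth)
    show "snd (initial_state xs) (pos e) = src e \<and> snd (initial_state xs) (pos e + 1) = trg e \<and>
        snd (initial_state xs) (pos e + 2) = length (labels e) \<and>
        (\<forall>i<length (labels e). snd (initial_state xs) (pos e + 3 + i) = labels e ! i)"
      using cell[of 0] cell[of 1] cell[of 2] cell[of "3 + i" for i]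
      by (simp add: rec add.assoc nth_append)
  qed
  \<comment> \<open>\<open>pow_base\<close> is exactly the length of the input.\<close>
  have zero: "snd (initial_state xs) a = 0" if "pow_base \<le> a" for a
    using that by (simp add: pow_base_def pos_def initial_state_def xs m)
  have head: "snd (initial_state xs) 0 = n" "snd (initial_state xs) 1 = m" "snd (initial_state xs) 2 = \<Delta>"
    by (simp_all add: initial_state_def xs n m)
  \<comment> \<open>The terms add up to at most \<open>408 * N + 167\<close>, and \<open>N\<close>
    is at least 16.\<close>
  have time: "m * 17 + (n * \<Delta> + 1) * 17 + m * (T * 30 + 40)
      + T * R * (20 * K + 36 * n + m * (35 + 100 * \<Delta>) + 93) + 20 * R + 150 \<le> 600 * N"
  proof -
    have "m * (T * 30 + 40) \<le> 70 * N"
      using b by (simp add: add_mult_distrib2 mult.assoc[symmetric])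
    moreover have "T * R * (20 * K + 36 * n + m * (35 + 100 * \<Delta>) + 93) =
        20 * (T * R * K) + 36 * (T * R * n) + 35 * (T * R * m) + 100 * (T * R * m * \<Delta>) + 93 * (T * R)"
      by (simp add: algebra_simps)
    then have "T * R * (20 * K + 36 * n + m * (35 + 100 * \<Delta>) + 93)
        \<le> 20 * N + 36 * N + 35 * N + 100 * N + 93 * N"
      using b by simp
    ultimately show ?thesis
      using b N16 by simp
  qed
  show ?thesis
    by (rule wp_mono[OF wp_tvc_com[OF head inp zero]])
      (use time Min_table in \<open>auto simp: R_def K_def\<close>)
qed

text \<open>Program and constants are chosen before the instance. The condition on \<open>w\<close>
  only asks for a word length of at least three times the binary logarithm of
  \<open>N\<close>.\<close>

theorem theorem7:
  "\<exists>(P :: com) (C :: nat) (c :: nat).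
     \<forall>(V :: 'v set) (E :: 'v set set) (lam :: 'v set \<Rightarrow> nat set) (\<Delta> :: nat) (xs :: nat list) (w :: nat).
       let n = card V; m = card E; T = lifetime E lam;
           N = T * \<Delta> * (n + m) * 2 ^ (n * (\<Delta> + 1))
       in temporal_graph V E lam \<and> 1 \<le> \<Delta> \<and> \<Delta> \<le> T \<and>
          encodes xs V E lam \<Delta> \<and> N ^ c \<le> 2 ^ w \<longrightarrow>
          (\<exists>t s. exec w P (initial_state xs) t s \<and> t \<le> C * N \<and>
                 result s = min_sliding_window_tvc V E lam \<Delta>)"
  unfolding Let_def result_def
  by (rule exI[of _ tvc_com], rule exI[of _ 600], rule exI[of _ 3])
    (use tvc_com_correct[unfolded wp_def] in blast)

end
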